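(* Let $f\in C^\infty(\mathbb{R}^2)$ satisfy $f(x)=O(|x|^{-a})$ as $|x|\to\infty$ for some $a>3$. Let $u\in C^\infty(\overline{\mathbb{R}^3_+})$, $\mathbb{R}^3_+=\{(x,t):x\in\mathbb{R}^2,t>0\}$, solve $$\Delta^2u=0\ \text{in }\mathbb{R}^3_+,\qquad \partial_tu(x,0)=0,\qquad \partial_t\Delta u(x,0)=-f(x)\quad (x\in\mathbb{R}^2),$$ and suppose $\lim_{|(x,t)|\to\infty}\frac{u(x,t)}{\sqrt{t^2+|x|^2}}=c$ for some constant $c>0$. Then there is a constant $C$ such that $$u(x,t)=\frac1{4\pi}\int_{\mathbb{R}^2}\sqrt{t^2+|x-y|^2}\,f(y)\,dy+C\qquad\text{for all }(x,t)\in\overline{\mathbb{R}^3_+}.$$ *)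

theory Defs
  imports "HOL-Analysis.Analysis" "HOL-Library.Landau_Symbols"
begin

definition pderiv_dir :: "'a::euclidean_space \<Rightarrow> ('a \<Rightarrow> real) \<Rightarrow> 'a \<Rightarrow> real" where
  "pderiv_dir b g p = deriv (\<lambda>s. g (p + s *\<^sub>R b)) 0"

fun iter_pderiv :: "'a::euclidean_space list \<Rightarrow> ('a \<Rightarrow> real) \<Rightarrow> 'a \<Rightarrow> real" where
  "iter_pderiv [] g = g"
| "iter_pderiv (b # bs) g = pderiv_dir b (iter_pderiv bs g)"

definition smooth :: "('a::euclidean_space \<Rightarrow> real) \<Rightarrow> bool" where
  "smooth g \<longleftrightarrow>
     (\<forall>bs. set bs \<subseteq> Basis \<longrightarrow>
        continuous_on UNIV (iter_pderiv bs g) \<and>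
        (\<forall>b\<in>Basis. \<forall>p. (\<lambda>s. iter_pderiv bs g (p + s *\<^sub>R b)) differentiable (at 0)))"

definition laplacian :: "('a::euclidean_space \<Rightarrow> real) \<Rightarrow> 'a \<Rightarrow> real" where
  "laplacian g p = (\<Sum>b\<in>Basis. pderiv_dir b (pderiv_dir b g) p)"

end

theory Submission
  imports Defs "HOL-Real_Asymp.Real_Asymp"
begin

text \<open>Extend \<open>u\<close> evenly in \<open>t\<close> to \<open>U\<close>. The Neumann data turn into \<open>\<Delta>\<^sup>2U = - 2 f \<delta>\<close> with \<open>\<delta>\<close>
  the surface measure of \<open>t = 0\<close>, so Green's identity on the half space is tested against a cut-off
  fundamental solution. The norm is regularized to \<open>\<phi> = sqrt (\<bar>X - P\<bar>\<^sup>2 + \<epsilon>\<^sup>2)\<close>, for which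
  \<open>\<Delta>\<^sup>2\<phi> = - 15 \<epsilon>\<^sup>4 / \<phi>\<^sup>7\<close> is \<open>- 8 \<pi>\<close> times an approximate identity; the test function is
  \<open>\<phi> (1 - (\<phi> / R)\<^sup>8)\<^sup>5\<close>, extended by zero. The cut-off contributes \<open>R\<^sup>-\<^sup>3\<close> times the integral of \<open>U\<close>
  against a kernel that is Lipschitz in \<open>\<phi> / R\<close>. On subtracting the identities with centres \<open>P\<close>
  and \<open>0\<close> this term tends to zero as \<open>R\<close> grows, because \<open>U = c \<bar>X\<bar> + o(\<bar>X\<bar>)\<close>; then let \<open>\<epsilon>\<close> tend to zero.\<close>

text \<open>The obstacle is the linear growth of \<open>u\<close>. The cut-off term integrates a
  bounded kernel against \<open>U\<close> over a ball of radius about \<open>R\<close>, so even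
  after the factor \<open>1 / R^3\<close> it can be of size \<open>R\<close>. Subtracting two
  centres gains a factor of order \<open>norm P / R\<close> from the Lipschitz bound and leaves size
  1. That suffices for the \<open>o(norm X)\<close> part of \<open>U\<close>, but not for
  \<open>c * norm X\<close>; there the evenness of the kernel replaces the first difference of the
  norm by a second difference, which decays. Only differences of \<open>U\<close> are recovered, and
  the value at 0 goes into \<open>C\<close>.

  The fifth power gives the test function a zero of order five at the cut-off, so its derivatives up
  to order four, and with them the bilaplacian, are continuous. The eighth power is chosen because
  the regularized bilaplacian lowers the exponent of \<open>\<phi> / R\<close> by up to 8: every
  expanded term \<open>(\<phi> / R)^(8 j + 1)\<close> with \<open>j \<ge> 1\<close> keeps a positive
  exponent, and only \<open>\<phi>\<close> itself becomes singular. Hence the Lipschitz constant is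
  uniform in \<open>\<epsilon> / R\<close>.

  The factor \<open>1 / (4 pi)\<close> is the 2 from the reflection divided by the mass
  \<open>8 pi\<close>.\<close>

type_synonym R3 = "(real^2) \<times> real"

section \<open>Radial integrals\<close>

text \<open>Layer-cake formula, in place of polar coordinates: \<open>g (norm x)\<close> is the
  integral of \<open>w\<close> over radii at least \<open>norm x\<close>, and exchanging the
  integrals leaves the volume of the ball of radius r as weight.\<close>

lemma nn_integral_radial:
  fixes g w :: "real \<Rightarrow> real"
  assumes w[measurable]: "w \<in> borel_measurable borel"
    and deriv: "\<And>r. r \<ge> 0 \<Longrightarrow> (g has_real_derivative - w r) (at r)"
    and nonneg: "\<And>r. r \<ge> 0 \<Longrightarrow> w r \<ge> 0"
    and lim: "(g \<longlongrightarrow> 0) at_top"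
  shows "(\<integral>\<^sup>+x. ennreal (g (norm (x::'a::euclidean_space))) \<partial>lborel) =
    (\<integral>\<^sup>+r. ennreal (w r * (unit_ball_vol DIM('a) * r ^ DIM('a))) * indicator {0..} r \<partial>lborel)"
proof -
  have g_eq: "(\<integral>\<^sup>+r. ennreal (w r) * indicator {norm x..} r \<partial>lborel) = ennreal (g (norm x))" for x :: 'a
  proof -
    have "((\<lambda>r. - g r) \<longlongrightarrow> 0) at_top"
      using tendsto_minus[OF lim] by simp
    moreover have "((\<lambda>r. - g r) has_real_derivative w r) (at r)" if "norm x \<le> r" for r
      using DERIV_minus[OF deriv[of r]] that norm_ge_zero[of x] by simp
    ultimately have "(\<integral>\<^sup>+r. ennreal (w r) * indicator {norm x..} r \<partial>lborel) = 0 - (- g (norm x))"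
      by (intro nn_integral_FTC_atLeast[OF w]) (auto intro: nonneg order_trans[OF norm_ge_zero])
    then show ?thesis by simp
  qed
  have "(\<integral>\<^sup>+x. ennreal (g (norm (x::'a))) \<partial>lborel)
      = (\<integral>\<^sup>+x. (\<integral>\<^sup>+r. ennreal (w r) * indicator {norm (x::'a)..} r \<partial>lborel) \<partial>lborel)"
    by (simp add: g_eq)
  also have "\<dots> = (\<integral>\<^sup>+x. (\<integral>\<^sup>+r. ennreal (w r) * indicator {(x, r). norm x \<le> r} (x::'a, r) \<partial>lborel) \<partial>lborel)"
    by (simp add: indicator_def)
  also have "\<dots> = (\<integral>\<^sup>+r. (\<integral>\<^sup>+x. ennreal (w r) * indicator {(x, r). norm x \<le> r} (x::'a, r) \<partial>lborel) \<partial>lborel)"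
    by (rule lborel_pair.Fubini'[symmetric]) measurable
  also have "\<dots> = (\<integral>\<^sup>+r. ennreal (w r * (unit_ball_vol DIM('a) * r ^ DIM('a))) * indicator {0..} r \<partial>lborel)"
  proof (rule nn_integral_cong)
    fix r :: real
    have eq: "(\<integral>\<^sup>+x. ennreal (w r) * indicator {(x, r). norm x \<le> r} (x::'a, r) \<partial>lborel)
        = ennreal (w r) * emeasure lborel (cball (0::'a) r)"
      by (subst nn_integral_cmult_indicator[symmetric]) (auto intro!: nn_integral_cong simp: indicator_def)
    show "(\<integral>\<^sup>+x. ennreal (w r) * indicator {(x, r). norm x \<le> r} (x::'a, r) \<partial>lborel)
        = ennreal (w r * (unit_ball_vol DIM('a) * r ^ DIM('a))) * indicator {0..} r"
    proof (cases "r \<ge> 0")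
      case True
      then show ?thesis
        unfolding eq by (simp add: emeasure_cball ennreal_mult nonneg)
    qed (simp add: eq)
  qed
  finally show ?thesis .
qed

text \<open>Against the ball volume, the weight \<open>w\<close> is at most a multiple of
  \<open>(1 + r) powr (n - p - 1)\<close>, which is integrable at infinity because \<open>p\<close>
  exceeds the dimension.\<close>

lemma integrable_one_plus_norm_powr:
  fixes p :: real
  assumes p: "p > DIM('a::euclidean_space)"
  shows "integrable lborel (\<lambda>x::'a. (1 + norm x) powr (- p))"
proof -
  define n where "n = DIM('a)"
  define V where "V = unit_ball_vol (real n)"
  have n: "real n < p" and p0: "p > 0" and V: "V \<ge> 0" using p by (auto simp: n_def V_def)
  define w where "w r = p * (1 + r) powr (- p - 1)" for r :: real
  have "(\<integral>\<^sup>+x. ennreal ((1 + norm (x::'a)) powr (- p)) \<partial>lborel)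
      = (\<integral>\<^sup>+r. ennreal (w r * (V * r ^ n)) * indicator {0..} r \<partial>lborel)"
    unfolding V_def n_def
  proof (rule nn_integral_radial)
    show "((\<lambda>r. (1 + r) powr (- p)) has_real_derivative - w r) (at r)" if "r \<ge> 0" for r
      using that unfolding w_def by (auto intro!: derivative_eq_intros)
    show "((\<lambda>r. (1 + r) powr (- p)) \<longlongrightarrow> 0) at_top"
      using p0 by real_asymp
  qed (use p0 in \<open>auto simp: w_def\<close>)
  also have "\<dots> \<le> (\<integral>\<^sup>+r. ennreal (p * V * (1 + r) powr (n - p - 1)) * indicator {0..} r \<partial>lborel)"
  proof (intro nn_integral_mono)
    fix r :: real
    have "w r * (V * r ^ n) \<le> p * V * (1 + r) powr (n - p - 1)" if "r \<ge> 0"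
    proof -
      have "r ^ n \<le> (1 + r) powr n"
        using that by (simp add: powr_realpow power_mono)
      then have "w r * (V * r ^ n) \<le> w r * (V * (1 + r) powr n)"
        using p0 V by (intro mult_left_mono) (auto simp: w_def)
      also have "\<dots> = p * V * ((1 + r) powr (- p - 1) * (1 + r) powr n)"
        by (simp add: w_def)
      also have "\<dots> = p * V * (1 + r) powr (n - p - 1)"
        by (subst powr_add[symmetric]) (simp add: algebra_simps)
      finally show ?thesis .
    qed
    then show "ennreal (w r * (V * r ^ n)) * indicator {0..} r
        \<le> ennreal (p * V * (1 + r) powr (n - p - 1)) * indicator {0..} r"
      by (auto simp: indicator_def intro: ennreal_leI)
  qed
  also have "\<dots> = ennreal (0 - p * V / (n - p) * (1 + 0) powr (n - p))"
  proof (rule nn_integral_FTC_atLeast)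
    show "((\<lambda>r. p * V / (n - p) * (1 + r) powr (n - p)) has_real_derivative
        p * V * (1 + r) powr (n - p - 1)) (at r)" if "0 \<le> r" for r
      using that n by (auto intro!: derivative_eq_intros)
    show "((\<lambda>r. p * V / (n - p) * (1 + r) powr (n - p)) \<longlongrightarrow> 0) at_top"
    proof -
      have "((\<lambda>r::real. (1 + r) powr (n - p)) \<longlongrightarrow> 0) at_top"
        using n by real_asymp
      then show ?thesis by (rule tendsto_mult_right_zero)
    qed
  qed (use p0 V in auto)
  finally have "(\<integral>\<^sup>+x. ennreal ((1 + norm (x::'a)) powr (- p)) \<partial>lborel) < \<infinity>"
    by (simp add: order_le_less_trans)
  then show ?thesis
    by (intro integrableI_nonneg) auto
qed

lemma integrable_one_plus_norm_power:
  assumes "n > DIM('a::euclidean_space)"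
  shows "integrable lborel (\<lambda>x::'a. 1 / (1 + norm x) ^ n)"
proof -
  have "(1 + norm x) powr (- real n) = 1 / (1 + norm x) ^ n" for x :: 'a
    using powr_realpow[of "1 + norm x" n]
    by (simp add: powr_minus divide_inverse add_pos_nonneg)
  with integrable_one_plus_norm_powr[where 'a='a and p="real n"] assms show ?thesis
    by simp
qed

text \<open>The mass of the kernel \<open>15 \<epsilon>^4 / \<phi>^7\<close>, computed at
  \<open>\<epsilon> = 1\<close>; it fixes the constant in the representation formula.\<close>

lemma integral_bubble:
  "(\<integral>(z::R3). 15 / sqrt ((norm z)\<^sup>2 + 1) ^ 7 \<partial>lborel) = 8 * pi"
proof -
  define V where "V = unit_ball_vol (3::nat)"
  have V: "V = 4 / 3 * pi" unfolding V_def using unit_ball_vol_3 by simp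
  define s where "s r = sqrt (r\<^sup>2 + 1)" for r :: real
  define w where "w r = 105 * r / s r ^ 9" for r :: real
  have sq: "s r ^ 2 = r\<^sup>2 + 1" "s r > 0" for r :: real
    by (auto simp: s_def add_nonneg_pos)
  have ds: "(s has_real_derivative r / s r) (at r)" for r :: real
    unfolding s_def using add_nonneg_pos[OF zero_le_power2[of r] zero_less_one]
    by (auto intro!: derivative_eq_intros simp: field_simps)
  have "(\<integral>\<^sup>+z. ennreal (15 / s (norm (z::R3)) ^ 7) \<partial>lborel)
     = (\<integral>\<^sup>+r. ennreal (w r * (unit_ball_vol DIM(R3) * r ^ DIM(R3))) * indicator {0..} r \<partial>lborel)"
  proof (rule nn_integral_radial)
    show "((\<lambda>r. 15 / s r ^ 7) has_real_derivative - w r) (at r)" if "r \<ge> 0" for r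
      using sq(2)[of r]
      by (auto intro!: derivative_eq_intros ds) (simp add: w_def field_simps eval_nat_numeral)
    show "((\<lambda>r::real. 15 / s r ^ 7) \<longlongrightarrow> 0) at_top"
      unfolding s_def by real_asymp
  qed (use sq(2) in \<open>auto simp: w_def s_def\<close>)
  also have "\<dots> = (\<integral>\<^sup>+r. ennreal (w r * (V * r ^ 3)) * indicator {0..} r \<partial>lborel)"
    by (simp add: V_def)
  \<comment> \<open>With q = r / s one has q' = 1 / s^3 and 1 - q^2 = 1 / s^2, so the integrand is
    105 V (q^4 - q^6) q'. Its primitive tends to 6 V = 8 pi as q tends to 1.\<close>
  also have "\<dots> = ennreal (8 * pi - V * (21 * (0 / s 0) ^ 5 - 15 * (0 / s 0) ^ 7))"
  proof (rule nn_integral_FTC_atLeast)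
    show "((\<lambda>r. V * (21 * (r / s r) ^ 5 - 15 * (r / s r) ^ 7)) has_real_derivative
        w r * (V * r ^ 3)) (at r)" for r
    proof -
      define S where "S = s r"
      have S: "S > 0" "S ^ 2 = r ^ 2 + 1" using sq by (simp_all add: S_def)
      have "((\<lambda>r. r / s r) has_real_derivative (S - r * (r / S)) / (S * S)) (at r)"
        using S by (auto intro!: derivative_eq_intros ds simp flip: S_def)
      moreover have "(S - r * (r / S)) / (S * S) = (S ^ 2 - r ^ 2) / S ^ 3"
        using S(1) by (simp add: field_simps eval_nat_numeral)
      ultimately have q: "((\<lambda>r. r / s r) has_real_derivative 1 / S ^ 3) (at r)"
        using S(2) by simp
      have "((\<lambda>r. V * (21 * (r / s r) ^ 5 - 15 * (r / s r) ^ 7)) has_real_derivative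
        V * (105 * (r / S) ^ 4 - 105 * (r / S) ^ 6) * (1 / S ^ 3)) (at r)"
        by (rule derivative_eq_intros q refl)+ (simp add: algebra_simps S_def)
      moreover have "(r / S) ^ 4 - (r / S) ^ 6 = r ^ 4 / S ^ 6"
      proof -
        have "(r / S) ^ 4 - (r / S) ^ 6 = r ^ 4 * (S ^ 2 - r ^ 2) / S ^ 6"
          using S(1) by (simp add: field_simps eval_nat_numeral)
        then show ?thesis using S(2) by simp
      qed
      then have "V * (105 * (r / S) ^ 4 - 105 * (r / S) ^ 6) * (1 / S ^ 3) = V * (105 * (r ^ 4 / S ^ 6)) * (1 / S ^ 3)"
        by (simp only: right_diff_distrib[symmetric])
      moreover have "\<dots> = w r * (V * r ^ 3)"
        using S(1) by (simp add: w_def S_def[symmetric] field_simps eval_nat_numeral)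
      ultimately show ?thesis by metis
    qed
    have "((\<lambda>r::real. r / s r) \<longlongrightarrow> 1) at_top"
      unfolding s_def by real_asymp
    then have "((\<lambda>r::real. V * (21 * (r / s r) ^ 5 - 15 * (r / s r) ^ 7))
        \<longlongrightarrow> V * (21 * 1 ^ 5 - 15 * 1 ^ 7)) at_top"
      by (intro tendsto_intros)
    then show "((\<lambda>r::real. V * (21 * (r / s r) ^ 5 - 15 * (r / s r) ^ 7))
        \<longlongrightarrow> 8 * pi) at_top"
      by (simp add: V)
  qed (auto simp: w_def V s_def intro!: divide_nonneg_nonneg)
  finally have nn: "(\<integral>\<^sup>+z. ennreal (15 / sqrt ((norm (z::R3))\<^sup>2 + 1) ^ 7) \<partial>lborel) = ennreal (8 * pi)"
    by (simp add: s_def)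
  have m: "(\<lambda>z::R3. 15 / sqrt ((norm z)\<^sup>2 + 1) ^ 7) \<in> borel_measurable lborel"
    by measurable
  have "has_bochner_integral lborel (\<lambda>z::R3. 15 / sqrt ((norm z)\<^sup>2 + 1) ^ 7) (8 * pi)"
    by (rule has_bochner_integral_nn_integral[OF m _ _ nn]) auto
  then show ?thesis
    by (auto simp: has_bochner_integral_iff)
qed

section \<open>Directional derivatives and smooth functions\<close>

text \<open>Relational counterpart of \<open>pderiv_dir\<close>: it also asserts differentiability,
  whereas \<open>deriv\<close> yields some value even where no derivative exists.\<close>

definition has_pderiv :: "'a::euclidean_space \<Rightarrow> ('a \<Rightarrow> real) \<Rightarrow> ('a \<Rightarrow> real) \<Rightarrow> bool" where
  "has_pderiv b g g' \<longleftrightarrow> (\<forall>p. ((\<lambda>s. g (p + s *\<^sub>R b)) has_real_derivative g' p) (at 0))"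

lemma has_pderivI:
  "(\<And>p. ((\<lambda>s. g (p + s *\<^sub>R b)) has_real_derivative g' p) (at 0)) \<Longrightarrow> has_pderiv b g g'"
  by (simp add: has_pderiv_def)

lemma has_pderivD:
  assumes "has_pderiv b g g'"
  shows "((\<lambda>s. g (p + s *\<^sub>R b)) has_real_derivative g' (p + s *\<^sub>R b)) (at s)"
proof -
  have "((\<lambda>r. g ((p + s *\<^sub>R b) + r *\<^sub>R b)) has_real_derivative g' (p + s *\<^sub>R b)) (at 0)"
    using assms unfolding has_pderiv_def by blast
  then have "((\<lambda>r. (\<lambda>s. g (p + s *\<^sub>R b)) (r + s)) has_real_derivative g' (p + s *\<^sub>R b)) (at 0)"
    by (simp add: algebra_simps)
  then show ?thesis
    using DERIV_shift[of "\<lambda>s. g (p + s *\<^sub>R b)" "g' (p + s *\<^sub>R b)" 0 s] by simp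
qed

lemma has_pderiv_imp_pderiv_dir: "has_pderiv b g g' \<Longrightarrow> pderiv_dir b g = g'"
  unfolding has_pderiv_def pderiv_dir_def by (auto intro: DERIV_imp_deriv)

lemma has_pderiv_add:
  assumes "has_pderiv b g g'" "has_pderiv b h h'"
  shows "has_pderiv b (\<lambda>p. g p + h p) (\<lambda>p. g' p + h' p)"
  using assms unfolding has_pderiv_def by (auto intro!: derivative_intros)

lemma has_pderiv_mult:
  assumes "has_pderiv b g g'" "has_pderiv b h h'"
  shows "has_pderiv b (\<lambda>p. g p * h p) (\<lambda>p. g' p * h p + g p * h' p)"
  using assms unfolding has_pderiv_def
  by (auto intro!: derivative_eq_intros)

lemma has_pderiv_diff:
  assumes "has_pderiv b g g'" "has_pderiv b h h'"
  shows "has_pderiv b (\<lambda>p. g p - h p) (\<lambda>p. g' p - h' p)"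
  using assms unfolding has_pderiv_def by (auto intro!: derivative_intros)

lemma has_pderiv_sum:
  assumes "\<And>i. i \<in> A \<Longrightarrow> has_pderiv b (g i) (g' i)"
  shows "has_pderiv b (\<lambda>p. \<Sum>i\<in>A. g i p) (\<lambda>p. \<Sum>i\<in>A. g' i p)"
  using assms unfolding has_pderiv_def by (auto intro!: DERIV_sum)

text \<open>The region \<open>norm p > M\<close> is open, so \<open>g\<close> vanishes along the
  line near \<open>p\<close>. Thus one radius bounds the supports of a test function and of its
  derivatives.\<close>

lemma has_pderiv_eq_0_outside:
  assumes g: "has_pderiv b g g'" and zero: "\<And>p. norm p > M \<Longrightarrow> g p = 0" and p: "norm p > M"
  shows "g' p = 0"
proof -
  have "((\<lambda>s. norm (p + s *\<^sub>R b)) \<longlongrightarrow> norm (p + 0 *\<^sub>R b)) (at 0)"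
    by (intro tendsto_intros)
  then have "\<forall>\<^sub>F s in at 0. norm (p + s *\<^sub>R b) > M"
    using p by (intro order_tendstoD(1)) auto
  then have "\<forall>\<^sub>F s in at 0. g (p + s *\<^sub>R b) = 0"
    by eventually_elim (rule zero)
  then have "\<forall>\<^sub>F s in nhds 0. g (p + s *\<^sub>R b) = 0"
    using zero[OF p] by (simp add: eventually_nhds_conv_at)
  moreover have "((\<lambda>s. g (p + s *\<^sub>R b)) has_real_derivative g' p) (at 0)"
    using g by (simp add: has_pderiv_def)
  ultimately have "((\<lambda>s. 0) has_real_derivative g' p) (at 0)"
    using DERIV_cong_ev[of 0 0 "\<lambda>s. g (p + s *\<^sub>R b)" "\<lambda>s. 0"] by blast
  then show ?thesis by (rule DERIV_unique) simp
qed

lemma iter_pderiv_append: "iter_pderiv (bs @ cs) g = iter_pderiv bs (iter_pderiv cs g)"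
  by (induction bs) auto

lemma smooth_has_pderiv: "smooth g \<Longrightarrow> b \<in> Basis \<Longrightarrow> has_pderiv b g (pderiv_dir b g)"
  unfolding has_pderiv_def pderiv_dir_def smooth_def
  by (metis DERIV_deriv_iff_real_differentiable iter_pderiv.simps(1) empty_set empty_subsetI)

lemma smooth_continuous: "smooth g \<Longrightarrow> continuous_on UNIV g"
  unfolding smooth_def by (metis iter_pderiv.simps(1) empty_set empty_subsetI)

lemma smooth_iter_pderiv:
  fixes g :: "'a::euclidean_space \<Rightarrow> real"
  assumes "smooth g" "set cs \<subseteq> Basis"
  shows "smooth (iter_pderiv cs g)"
  unfolding smooth_def
proof (intro allI impI)
  fix bs :: "'a list" assume "set bs \<subseteq> Basis"
  then have "set (bs @ cs) \<subseteq> Basis" using assms by auto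
  then show "continuous_on UNIV (iter_pderiv bs (iter_pderiv cs g)) \<and>
      (\<forall>b\<in>Basis. \<forall>p. (\<lambda>s. iter_pderiv bs (iter_pderiv cs g) (p + s *\<^sub>R b)) differentiable (at 0))"
    using assms(1) unfolding smooth_def iter_pderiv_append[symmetric] by blast
qed

lemma smooth_pderiv_dir: "smooth g \<Longrightarrow> b \<in> Basis \<Longrightarrow> smooth (pderiv_dir b g)"
  using smooth_iter_pderiv[of g "[b]"] by simp

text \<open>Iterated derivatives commute with finite sums, by induction on the list. The purpose is
  smoothness of \<open>laplacian u\<close>, to which Green's identity is applied as well.\<close>

lemma smooth_sum:
  fixes g :: "'b \<Rightarrow> 'a::euclidean_space \<Rightarrow> real"
  assumes "\<And>i. i \<in> A \<Longrightarrow> smooth (g i)"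
  shows "smooth (\<lambda>p. \<Sum>i\<in>A. g i p)"
proof -
  have iter: "iter_pderiv bs (\<lambda>p. \<Sum>i\<in>A. g i p) = (\<lambda>p. \<Sum>i\<in>A. iter_pderiv bs (g i) p)"
    if "set bs \<subseteq> Basis" for bs
    using that
  proof (induction bs)
    case (Cons b bs)
    have "has_pderiv b (\<lambda>p. \<Sum>i\<in>A. iter_pderiv bs (g i) p) (\<lambda>p. \<Sum>i\<in>A. pderiv_dir b (iter_pderiv bs (g i)) p)"
      using Cons.prems assms by (intro has_pderiv_sum smooth_has_pderiv smooth_iter_pderiv) auto
    with Cons show ?case
      by (simp add: has_pderiv_imp_pderiv_dir)
  qed simp
  show ?thesis
    unfolding smooth_def
  proof (intro allI impI conjI ballI)
    fix bs :: "'a list" assume bs: "set bs \<subseteq> Basis"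
    have sm: "smooth (iter_pderiv bs (g i))" if "i \<in> A" for i
      using assms bs that by (intro smooth_iter_pderiv)
    show "continuous_on UNIV (iter_pderiv bs (\<lambda>p. \<Sum>i\<in>A. g i p))"
      unfolding iter[OF bs] by (intro continuous_on_sum smooth_continuous sm)
    fix b p :: 'a assume "b \<in> Basis"
    then have "has_pderiv b (\<lambda>p. \<Sum>i\<in>A. iter_pderiv bs (g i) p) (\<lambda>p. \<Sum>i\<in>A. pderiv_dir b (iter_pderiv bs (g i)) p)"
      by (intro has_pderiv_sum smooth_has_pderiv sm)
    then show "(\<lambda>s. iter_pderiv bs (\<lambda>p. \<Sum>i\<in>A. g i p) (p + s *\<^sub>R b)) differentiable (at 0)"
      unfolding iter[OF bs] has_pderiv_def by (meson real_differentiable_def)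
  qed
qed

lemma smooth_laplacian: "smooth g \<Longrightarrow> smooth (laplacian g)"
  unfolding laplacian_def[abs_def] by (intro smooth_sum smooth_pderiv_dir)

section \<open>Green's identity on the half space\<close>

lemma borel_measurable_continuous_UNIV:
  fixes g :: "'a::euclidean_space \<Rightarrow> real"
  shows "continuous_on UNIV g \<Longrightarrow> g \<in> borel_measurable borel"
  by (rule borel_measurable_continuous_onI)

lemma integrable_compact_support:
  fixes g :: "'a::euclidean_space \<Rightarrow> real"
  assumes g: "continuous_on UNIV g" and zero: "\<And>p. norm p > M \<Longrightarrow> g p = 0"
  shows "integrable lborel g"
proof -
  have "integrable lborel (\<lambda>x. indicator (cball 0 M) x *\<^sub>R g x)"
    by (intro borel_integrable_compact compact_cball continuous_on_subset[OF g]) auto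
  also have "(\<lambda>x. indicator (cball 0 M) x *\<^sub>R g x) = g"
    using zero by (auto simp: indicator_def fun_eq_iff not_le)
  finally show ?thesis .
qed

lemma integrable_indicator_cball: "integrable lborel (indicator (cball (x::'a::euclidean_space) r) :: 'a \<Rightarrow> real)"
  using emeasure_lborel_cball_finite[of x r] by (intro integrable_real_indicator) auto

lemma integral_lborel_translate:
  fixes h :: "'a::euclidean_space \<Rightarrow> real"
  assumes [measurable]: "h \<in> borel_measurable borel"
  shows "(\<integral>p. h (p + c) \<partial>lborel) = (\<integral>p. h p \<partial>lborel)"
proof -
  have "(\<integral>p. h p \<partial>lborel) = (\<integral>p. h p \<partial>(distr lborel borel ((+) c)))"
    by (simp add: lborel_distr_plus)
  also have "\<dots> = (\<integral>p. h (c + p) \<partial>lborel)"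
    by (subst integral_distr) auto
  finally show ?thesis by (simp add: add.commute)
qed

lemma integrable_lborel_translate:
  fixes h :: "'a::euclidean_space \<Rightarrow> real"
  assumes "integrable lborel h"
  shows "integrable lborel (\<lambda>p. h (p + c))"
proof -
  have "integrable (distr lborel borel ((+) c)) h"
    using assms by (simp add: lborel_distr_plus)
  then have "integrable lborel (\<lambda>p. h (c + p))"
    by (subst (asm) integrable_distr_eq) (use assms in auto)
  then show ?thesis by (simp add: add.commute)
qed

text \<open>The integral over \<open>S\<close> is invariant under translation along \<open>b\<close>, hence the difference quotients
  integrate to zero; this avoids iterated integrals.\<close>
lemma integral_pderiv_invariant_set:
  fixes g g' :: "'a::euclidean_space \<Rightarrow> real"
  assumes g: "has_pderiv b g g'" and cont: "continuous_on UNIV g" and cont': "continuous_on UNIV g'"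
    and zero: "\<And>p. norm p > M \<Longrightarrow> g p = 0"
    and S[measurable]: "S \<in> sets borel" and inv: "\<And>p s. p + s *\<^sub>R b \<in> S \<longleftrightarrow> p \<in> S"
  shows "(\<integral>p. indicator S p * g' p \<partial>lborel) = 0"
proof -
  note [measurable] = borel_measurable_continuous_UNIV[OF cont] borel_measurable_continuous_UNIV[OF cont']
  define \<sigma> where "\<sigma> n = inverse (real (Suc n))" for n
  have \<sigma>: "\<sigma> n > 0" "\<sigma> n \<le> 1" for n by (auto simp: \<sigma>_def field_simps)
  have \<sigma>_lim: "filterlim \<sigma> (at 0) sequentially"
    unfolding filterlim_at using LIMSEQ_inverse_real_of_nat \<sigma>(1)
    by (auto simp: \<sigma>_def[abs_def])
  \<comment> \<open>A point of norm at most \<open>M + norm b\<close>, moved by at most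
    \<open>norm b\<close> in the mean value theorem below, stays in this ball; farther out both
    values of \<open>g\<close> in the quotient vanish.\<close>
  obtain B where B: "\<And>p. norm p \<le> M + 2 * norm b \<Longrightarrow> \<bar>g' p\<bar> \<le> B"
  proof -
    have "compact (g' ` cball 0 (M + 2 * norm b))"
      by (intro compact_continuous_image continuous_on_subset[OF cont'] compact_cball) auto
    then obtain B where "\<forall>y \<in> g' ` cball 0 (M + 2 * norm b). norm y \<le> B"
      using compact_imp_bounded bounded_iff by metis
    then show ?thesis by (intro that[of B]) auto
  qed
  define D where "D n p = indicator S p * ((g (p + \<sigma> n *\<^sub>R b) - g p) / \<sigma> n)" for n p
  have int: "integrable lborel g" by (rule integrable_compact_support[OF cont zero])
  have intS: "integrable lborel (\<lambda>p. indicator S p * g p)"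
    using integrable_real_mult_indicator[OF _ int, of S] by (simp add: mult.commute)
  have D0: "(\<integral>p. D n p \<partial>lborel) = 0" for n
  proof -
    define h where "h p = indicator S p * g p" for p
    have "D n p = (h (p + \<sigma> n *\<^sub>R b) - h p) / \<sigma> n" for p
      using inv[of p "\<sigma> n"] by (auto simp: D_def h_def indicator_def)
    moreover have "integrable lborel h" using intS by (simp add: h_def[abs_def])
    ultimately show ?thesis
      using integral_lborel_translate[of h] integrable_lborel_translate[of h]
      by simp
  qed
  have "(\<lambda>n. \<integral>p. D n p \<partial>lborel) \<longlonglongrightarrow> (\<integral>p. indicator S p * g' p \<partial>lborel)"
  proof (rule integral_dominated_convergence)
    show "integrable lborel (\<lambda>p. B * indicator (cball 0 (M + norm b)) p :: real)"
      by (intro integrable_mult_right integrable_indicator_cball)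
    show "AE p in lborel. (\<lambda>n. D n p) \<longlonglongrightarrow> indicator S p * g' p"
    proof (rule AE_I2)
      fix p
      have "((\<lambda>s. g (p + s *\<^sub>R b)) has_real_derivative g' p) (at 0)"
        using g by (simp add: has_pderiv_def)
      then have "((\<lambda>s. (g (p + s *\<^sub>R b) - g p) / s) \<longlongrightarrow> g' p) (at 0)"
        by (simp add: DERIV_def)
      from filterlim_compose[OF this \<sigma>_lim]
      show "(\<lambda>n. D n p) \<longlonglongrightarrow> indicator S p * g' p"
        unfolding D_def by (intro tendsto_intros)
    qed
    show "AE p in lborel. norm (D n p) \<le> B * indicator (cball 0 (M + norm b)) p" for n
    proof (rule AE_I2)
      fix p
      have tri: "norm (p + s *\<^sub>R b) \<le> norm p + norm b" "norm p \<le> norm (p + s *\<^sub>R b) + norm b"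
        if "0 \<le> s" "s \<le> 1" for s
      proof -
        have "norm (s *\<^sub>R b) \<le> norm b" using that by (simp add: mult_left_le_one_le)
        then show "norm (p + s *\<^sub>R b) \<le> norm p + norm b"
          using norm_triangle_ineq[of p "s *\<^sub>R b"] by linarith
        have "norm p \<le> norm (p + s *\<^sub>R b) + norm (s *\<^sub>R b)"
          using norm_triangle_ineq4[of "p + s *\<^sub>R b" "s *\<^sub>R b"] by simp
        with \<open>norm (s *\<^sub>R b) \<le> norm b\<close> show "norm p \<le> norm (p + s *\<^sub>R b) + norm b" by linarith
      qed
      show "norm (D n p) \<le> B * indicator (cball 0 (M + norm b)) p"
      proof (cases "norm p \<le> M + norm b")
        case True
        obtain z where z: "0 < z" "z < \<sigma> n"
            "g (p + \<sigma> n *\<^sub>R b) - g (p + 0 *\<^sub>R b) = (\<sigma> n - 0) * g' (p + z *\<^sub>R b)"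
          using MVT2[of 0 "\<sigma> n" "\<lambda>s. g (p + s *\<^sub>R b)" "\<lambda>s. g' (p + s *\<^sub>R b)"]
            has_pderivD[OF g] \<sigma>(1) by blast
        have "\<bar>g' (p + z *\<^sub>R b)\<bar> \<le> B"
          using z \<sigma>(2)[of n] tri(1)[of z] True by (intro B) auto
        moreover have "(g (p + \<sigma> n *\<^sub>R b) - g p) / \<sigma> n = g' (p + z *\<^sub>R b)"
          using z(3) \<sigma>(1)[of n] by simp
        ultimately show ?thesis
          using True by (auto simp: D_def indicator_def)
      next
        case False
        then have "g p = 0" "g (p + \<sigma> n *\<^sub>R b) = 0"
          using tri(2)[of "\<sigma> n"] \<sigma>[of n] norm_ge_zero[of b] by (intro zero; linarith)+
        then show ?thesis using False by (simp add: D_def)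
      qed
    qed
  qed (auto simp: D_def[abs_def])
  then have "(\<lambda>n. 0) \<longlonglongrightarrow> (\<integral>p. indicator S p * g' p \<partial>lborel)"
    by (simp only: D0)
  then show ?thesis
    by (metis LIMSEQ_unique tendsto_const)
qed

text \<open>The half space is not invariant in the normal direction, so here the integral is
  iterated: the fundamental theorem on each normal segment from 0 to \<open>N\<close> leaves the
  value at t = 0, as \<open>N\<close> lies beyond the support.\<close>

lemma integral_normal_pderiv_half_space:
  fixes g g' :: "'a::euclidean_space \<times> real \<Rightarrow> real"
  assumes g: "has_pderiv (0, 1) g g'" and cont: "continuous_on UNIV g" and cont': "continuous_on UNIV g'"
    and zero: "\<And>p. norm p > M \<Longrightarrow> g p = 0"
  shows "(\<integral>p. indicator {p. snd p \<ge> 0} p * g' p \<partial>lborel) = - (\<integral>y. g (y, 0) \<partial>lborel)"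
proof -
  note [measurable] = borel_measurable_continuous_UNIV[OF cont] borel_measurable_continuous_UNIV[OF cont']
  have zero': "g' p = 0" if "norm p > M" for p
    by (rule has_pderiv_eq_0_outside[OF g zero that])
  define N where "N = \<bar>M\<bar> + 1"
  have N: "N \<ge> 0" "N > M" by (auto simp: N_def)
  have S[measurable]: "{p :: 'a \<times> real. snd p \<ge> 0} \<in> sets borel"
    by (intro borel_closed closed_Collect_le continuous_intros)
  have "integrable lborel (\<lambda>p. indicator {p. snd p \<ge> 0} p * g' p)"
    using integrable_real_mult_indicator[OF _ integrable_compact_support[OF cont' zero'], of "{p. snd p \<ge> 0}"] S
    by (simp add: mult.commute)
  then have "integrable (lborel \<Otimes>\<^sub>M lborel) (\<lambda>p. indicator {p. snd p \<ge> 0} p * g' p)"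
    by (simp add: lborel_prod)
  from lborel_pair.integral_fst'[OF this]
  have "(\<integral>p. indicator {p. snd p \<ge> 0} p * g' p \<partial>lborel)
      = (\<integral>x. (\<integral>t. indicator {p. snd p \<ge> 0} (x, t) * g' (x, t) \<partial>lborel) \<partial>lborel)"
    by (simp add: lborel_prod)
  also have "\<dots> = (\<integral>x. - g (x, 0) \<partial>lborel)"
  proof (rule Bochner_Integration.integral_cong[OF refl])
    fix x :: 'a
    have big: "norm (x, t) > M" if "t \<ge> N" for t
      using that N norm_snd_le[of t x] by simp
    have "(\<integral>t. indicator {p. snd p \<ge> 0} (x, t) * g' (x, t) \<partial>lborel) = (\<integral>t. g' (x, t) * indicator {0..N} t \<partial>lborel)"
      using zero'[OF big] by (intro Bochner_Integration.integral_cong) (auto simp: indicator_def)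
    also have "\<dots> = g (x, N) - g (x, 0)"
    proof (rule integral_FTC_Icc_real)
      show "0 \<le> N" by fact
      show "((\<lambda>t. g (x, t)) has_real_derivative g' (x, t)) (at t)" for t
        using has_pderivD[OF g, of "(x, 0)" t] by simp
      show "isCont (\<lambda>t. g' (x, t)) t" for t
        using continuous_on_compose2[OF cont', of UNIV "\<lambda>t. (x, t)"]
        by (auto simp: continuous_on_eq_continuous_at intro!: continuous_intros)
    qed
    also have "g (x, N) = 0" by (intro zero big) simp
    finally show "(\<integral>t. indicator {p. snd p \<ge> 0} (x, t) * g' (x, t) \<partial>lborel) = - g (x, 0)" by simp
  qed
  finally show ?thesis by simp
qed

text \<open>Divergence theorem for the field \<open>v grad \<psi> - \<psi> grad v\<close>, whose
  component along \<open>b\<close> is \<open>g b\<close>: tangential components integrate to zero,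
  the normal one gives the boundary term. The derivatives of \<open>\<psi>\<close> are passed
  explicitly because the cut-off test functions have only finitely many continuous
  derivatives.\<close>

lemma Green_half_space:
  fixes v \<psi> :: "'a::euclidean_space \<times> real \<Rightarrow> real" and \<psi>1 \<psi>2 :: "'a \<times> real \<Rightarrow> 'a \<times> real \<Rightarrow> real"
  assumes v: "smooth v"
    and \<psi>: "\<And>b. b \<in> Basis \<Longrightarrow> has_pderiv b \<psi> (\<psi>1 b)" "\<And>b. b \<in> Basis \<Longrightarrow> has_pderiv b (\<psi>1 b) (\<psi>2 b)"
    and cont: "continuous_on UNIV \<psi>" "\<And>b. b \<in> Basis \<Longrightarrow> continuous_on UNIV (\<psi>1 b)"
      "\<And>b. b \<in> Basis \<Longrightarrow> continuous_on UNIV (\<psi>2 b)"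
    and zero: "\<And>p. norm p > M \<Longrightarrow> \<psi> p = 0"
  shows "(\<integral>p. indicator {p. snd p \<ge> 0} p * (v p * (\<Sum>b\<in>Basis. \<psi>2 b p) - \<psi> p * laplacian v p) \<partial>lborel)
    = - (\<integral>y. v (y, 0) * \<psi>1 (0, 1) (y, 0) - \<psi> (y, 0) * pderiv_dir (0, 1) v (y, 0) \<partial>lborel)"
proof -
  let ?H = "{p :: 'a \<times> real. snd p \<ge> 0}"
  have H[measurable]: "?H \<in> sets borel"
    by (intro borel_closed closed_Collect_le continuous_intros)
  define v1 where "v1 b = pderiv_dir b v" for b
  define v2 where "v2 b = pderiv_dir b (v1 b)" for b
  have v1: "has_pderiv b v (v1 b)" "has_pderiv b (v1 b) (v2 b)" "continuous_on UNIV v" "continuous_on UNIV (v1 b)"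
      "continuous_on UNIV (v2 b)" if "b \<in> Basis" for b
    unfolding v1_def v2_def
    by (intro smooth_has_pderiv smooth_continuous smooth_pderiv_dir v that)+
  have zero1: "\<psi>1 b p = 0" if "b \<in> Basis" "norm p > M" for b p
    by (rule has_pderiv_eq_0_outside[OF \<psi>(1)[OF that(1)] zero that(2)])
  have zero2: "\<psi>2 b p = 0" if "b \<in> Basis" "norm p > M" for b p
    by (rule has_pderiv_eq_0_outside[OF \<psi>(2)[OF that(1)] zero1[OF that(1)] that(2)])
  define g where "g b p = v p * \<psi>1 b p - \<psi> p * v1 b p" for b p
  define g' where "g' b p = v p * \<psi>2 b p - \<psi> p * v2 b p" for b p
  have g: "has_pderiv b (g b) (g' b)" "continuous_on UNIV (g b)" "continuous_on UNIV (g' b)"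
    "\<And>p. norm p > M \<Longrightarrow> g b p = 0" "\<And>p. norm p > M \<Longrightarrow> g' b p = 0" if "b \<in> Basis" for b
  proof -
    have "has_pderiv b (\<lambda>p. v p * \<psi>1 b p - \<psi> p * v1 b p)
      (\<lambda>p. (v1 b p * \<psi>1 b p + v p * \<psi>2 b p) - (\<psi>1 b p * v1 b p + \<psi> p * v2 b p))"
      by (intro has_pderiv_diff has_pderiv_mult v1 \<psi> that)
    then show "has_pderiv b (g b) (g' b)"
      unfolding g_def[abs_def] g'_def[abs_def] by (simp add: algebra_simps)
    show "continuous_on UNIV (g b)" "continuous_on UNIV (g' b)"
      unfolding g_def[abs_def] g'_def[abs_def]
      using v1(3-5)[OF that] cont(1) cont(2,3)[OF that] by (auto intro!: continuous_intros)
    show "g b p = 0" "g' b p = 0" if "norm p > M" for p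
      using that \<open>b \<in> Basis\<close> by (auto simp: g_def g'_def zero zero1 zero2)
  qed
  have "(\<integral>p. indicator ?H p * (v p * (\<Sum>b\<in>Basis. \<psi>2 b p) - \<psi> p * laplacian v p) \<partial>lborel)
      = (\<integral>p. (\<Sum>b\<in>Basis. indicator ?H p * g' b p) \<partial>lborel)"
    by (intro Bochner_Integration.integral_cong)
       (auto simp: g'_def laplacian_def v2_def v1_def sum_subtractf sum_distrib_left algebra_simps)
  also have "\<dots> = (\<Sum>b\<in>Basis. \<integral>p. indicator ?H p * g' b p \<partial>lborel)"
  proof (rule Bochner_Integration.integral_sum)
    fix b :: "'a \<times> real" assume "b \<in> Basis"
    show "integrable lborel (\<lambda>p. indicator ?H p * g' b p)"
      using integrable_real_mult_indicator[OF _ integrable_compact_support[OF g(3)[OF \<open>b \<in> Basis\<close>] g(5)[OF \<open>b \<in> Basis\<close>]], of ?H] H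
      by (simp add: mult.commute)
  qed
  also have "\<dots> = (\<Sum>b\<in>Basis. if b = (0, 1) then - (\<integral>y. g b (y, 0) \<partial>lborel) else 0)"
  proof (rule sum.cong[OF refl])
    fix b :: "'a \<times> real" assume b: "b \<in> Basis"
    show "(\<integral>p. indicator ?H p * g' b p \<partial>lborel) = (if b = (0, 1) then - (\<integral>y. g b (y, 0) \<partial>lborel) else 0)"
    proof (cases "b = (0, 1)")
      case True
      with g[OF b] show ?thesis
        using integral_normal_pderiv_half_space[of "g b" "g' b" M] by simp
    next
      case False
      with b have "snd b = 0" by (auto simp: Basis_prod_def)
      then have "(\<integral>p. indicator ?H p * g' b p \<partial>lborel) = 0"
        by (intro integral_pderiv_invariant_set[OF g(1-4)[OF b] H]) auto
      with False show ?thesis by simp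
    qed
  qed
  also have "\<dots> = - (\<integral>y. g (0, 1) (y, 0) \<partial>lborel)"
    by (subst sum.delta) (auto simp: Basis_prod_def)
  finally show ?thesis by (simp add: g_def v1_def)
qed

section \<open>Radial test functions\<close>

text \<open>The radial variable is the squared regularized distance over \<open>R^2\<close>, a
  polynomial in X that stays positive; so \<open>H\<close> need only be differentiable on the
  positive reals and nothing is singular at \<open>P\<close>.\<close>

lemma has_pderiv_radial:
  fixes P :: "'a::euclidean_space"
  assumes H: "\<And>x. x > 0 \<Longrightarrow> (H has_real_derivative H' x) (at x)" and "\<epsilon> > 0" "R > 0"
  shows "has_pderiv b (\<lambda>X. H (((norm (X - P))\<^sup>2 + \<epsilon>\<^sup>2) / R\<^sup>2))
    (\<lambda>X. H' (((norm (X - P))\<^sup>2 + \<epsilon>\<^sup>2) / R\<^sup>2) * (2 * ((X - P) \<bullet> b) / R\<^sup>2))"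
proof (rule has_pderivI)
  fix X
  let ?q = "\<lambda>s. ((norm (X + s *\<^sub>R b - P))\<^sup>2 + \<epsilon>\<^sup>2) / R\<^sup>2"
  have shift: "X + s *\<^sub>R b - P = (X - P) + s *\<^sub>R b" for s
    by simp
  have "?q = (\<lambda>s. ((norm (X - P))\<^sup>2 + 2 * s * ((X - P) \<bullet> b) + s\<^sup>2 * (b \<bullet> b) + \<epsilon>\<^sup>2) / R\<^sup>2)"
    unfolding shift power2_norm_eq_inner inner_add_left inner_add_right inner_scaleR_left inner_scaleR_right
    by (simp add: fun_eq_iff inner_commute power2_eq_square distrib_left mult_ac)
  moreover have "((\<lambda>s. (norm (X - P))\<^sup>2 + 2 * s * ((X - P) \<bullet> b) + s\<^sup>2 * (b \<bullet> b) + \<epsilon>\<^sup>2) has_real_derivative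
      2 * ((X - P) \<bullet> b)) (at 0)"
    by (auto intro!: derivative_eq_intros)
  ultimately have q: "(?q has_real_derivative 2 * ((X - P) \<bullet> b) / R\<^sup>2) (at 0)"
    by (simp only: DERIV_cdivide)
  have "?q 0 > 0" using assms(2,3) by (auto intro!: divide_pos_pos add_nonneg_pos)
  from DERIV_chain2[OF H[OF this] q]
  show "((\<lambda>s. H (?q s)) has_real_derivative
      H' (((norm (X - P))\<^sup>2 + \<epsilon>\<^sup>2) / R\<^sup>2) * (2 * ((X - P) \<bullet> b) / R\<^sup>2)) (at 0)" by simp
qed

lemma has_pderiv_radial2:
  fixes P :: "'a::euclidean_space"
  assumes H: "\<And>x. x > 0 \<Longrightarrow> (H' has_real_derivative H'' x) (at x)" and "\<epsilon> > 0" "R > 0" and b: "b \<in> Basis"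
  shows "has_pderiv b (\<lambda>X. H' (((norm (X - P))\<^sup>2 + \<epsilon>\<^sup>2) / R\<^sup>2) * (2 * ((X - P) \<bullet> b) / R\<^sup>2))
    (\<lambda>X. H'' (((norm (X - P))\<^sup>2 + \<epsilon>\<^sup>2) / R\<^sup>2) * (2 * ((X - P) \<bullet> b) / R\<^sup>2)\<^sup>2
      + H' (((norm (X - P))\<^sup>2 + \<epsilon>\<^sup>2) / R\<^sup>2) * (2 / R\<^sup>2))"
proof -
  have "has_pderiv b (\<lambda>X. 2 * ((X - P) \<bullet> b) / R\<^sup>2) (\<lambda>X. 2 / R\<^sup>2)"
  proof (rule has_pderivI)
    fix X
    have "(\<lambda>s. 2 * ((X + s *\<^sub>R b - P) \<bullet> b) / R\<^sup>2) = (\<lambda>s. 2 * ((X - P) \<bullet> b) / R\<^sup>2 + s * (2 / R\<^sup>2))"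
      using b \<open>R > 0\<close> by (simp add: fun_eq_iff field_simps inner_add_left inner_diff_left)
    moreover have "((\<lambda>s. 2 * ((X - P) \<bullet> b) / R\<^sup>2 + s * (2 / R\<^sup>2)) has_real_derivative 0 + 1 * (2 / R\<^sup>2)) (at 0)"
      by (intro DERIV_add DERIV_const DERIV_cmult_right DERIV_ident)
    ultimately show "((\<lambda>s. 2 * ((X + s *\<^sub>R b - P) \<bullet> b) / R\<^sup>2) has_real_derivative 2 / R\<^sup>2) (at 0)"
      by simp
  qed
  from has_pderiv_mult[OF has_pderiv_radial[OF assms(1-3)] this]
  show ?thesis by (simp add: power2_eq_square mult.assoc)
qed

lemma continuous_on_radial:
  fixes P :: "'a::euclidean_space"
  assumes "continuous_on {0<..} H" "\<epsilon> > 0" "R > 0"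
  shows "continuous_on UNIV (\<lambda>X. H (((norm (X - P))\<^sup>2 + \<epsilon>\<^sup>2) / R\<^sup>2))"
  using assms(2,3)
  by (intro continuous_on_compose2[OF assms(1)] continuous_intros) (auto intro!: divide_pos_pos add_nonneg_pos)

text \<open>The squared gradient of the radial variable is a multiple of
  \<open>(norm (X - P))^2\<close>, that is, of the variable minus \<open>(\<epsilon> / R)^2\<close>.
  Hence the Laplacian of a radial function is a function of the same variable and can be
  iterated.\<close>

lemma laplacian_radial_eq:
  fixes P X :: "'a::euclidean_space"
  assumes "R > 0"
  shows "(\<Sum>b\<in>Basis. c * (2 * ((X - P) \<bullet> b) / R\<^sup>2)\<^sup>2 + d * (2 / R\<^sup>2))
    = (4 * (((norm (X - P))\<^sup>2 + \<epsilon>\<^sup>2) / R\<^sup>2 - (\<epsilon> / R)\<^sup>2) * c + 2 * real DIM('a) * d) / R\<^sup>2"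
proof -
  have "(\<Sum>b\<in>Basis. c * (2 * ((X - P) \<bullet> b) / R\<^sup>2)\<^sup>2 + d * (2 / R\<^sup>2))
     = c * 4 / (R\<^sup>2)\<^sup>2 * (\<Sum>b\<in>Basis. ((X - P) \<bullet> b)\<^sup>2) + DIM('a) * d * 2 / R\<^sup>2"
    by (simp add: sum.distrib sum_distrib_left sum_divide_distrib power_divide power_mult_distrib mult_ac)
  also have "(\<Sum>b\<in>Basis. ((X - P) \<bullet> b)\<^sup>2) = (norm (X - P))\<^sup>2"
    unfolding power2_norm_eq_inner euclidean_inner[of "X - P" "X - P"] by (simp add: power2_eq_square)
  finally show ?thesis
    using assms by (simp add: field_simps power2_eq_square)
qed

section \<open>The cut-off profile, its derivatives and its bilaplacian\<close>

definition falling :: "nat \<Rightarrow> real \<Rightarrow> real" where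
  "falling k a = (\<Prod>i<k. a - real i)"

text \<open>Coefficients in the k-th derivative of the binomial expansion of
  \<open>sqrt x (1 - x^4)^5\<close>; the falling factorial is what k differentiations of
  \<open>x powr (4 j + 1/2)\<close> bring down.\<close>

definition profile_coeff :: "nat \<Rightarrow> nat \<Rightarrow> real" where
  "profile_coeff k j = (-1) ^ j * real (5 choose j) * falling k (4 * real j + 1 / 2)"

definition profile_poly :: "nat \<Rightarrow> real \<Rightarrow> real" where
  "profile_poly k x = (\<Sum>j\<le>5. profile_coeff k j * x powr (4 * real j + 1 / 2 - real k))"

text \<open>\<open>profile k\<close> is the \<open>k\<close>-th derivative of the cut-off square root, which equals
  \<open>sqrt x * (1 - x ^ 4) ^ 5\<close> on \<open>(0,1)\<close> and vanishes beyond.\<close>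
definition profile :: "nat \<Rightarrow> real \<Rightarrow> real" where
  "profile k x = (if x < 1 then profile_poly k x else 0)"

lemma DERIV_profile_poly:
  assumes "x > 0"
  shows "(profile_poly k has_real_derivative profile_poly (Suc k) x) (at x)"
  unfolding profile_poly_def[abs_def]
proof (rule DERIV_sum)
  fix j
  let ?a = "4 * real j + 1 / 2"
  have "((\<lambda>x. profile_coeff k j * x powr (?a - real k)) has_real_derivative
      profile_coeff k j * ((?a - real k) * x powr (?a - real k - 1))) (at x)"
    using assms by (intro DERIV_cmult has_real_derivative_powr)
  moreover have "profile_coeff (Suc k) j = profile_coeff k j * (?a - real k)"
    by (simp add: profile_coeff_def falling_def)
  ultimately show "((\<lambda>x. profile_coeff k j * x powr (?a - real k)) has_real_derivative
      profile_coeff (Suc k) j * x powr (?a - real (Suc k))) (at x)"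
    by (simp add: diff_diff_eq add.commute mult.assoc)
qed

lemma choose_5: "(5 choose 2) = (10::nat)" "(5 choose 3) = (10::nat)" "(5 choose 4) = (5::nat)"
  by (simp_all add: eval_nat_numeral)

text \<open>The factor \<open>(1 - x^4)^5\<close> has a zero of order five at 1, so exactly the
  orders up to 4 are available; the proof just evaluates the coefficients.\<close>

lemma profile_poly_1:
  assumes "k \<le> 4"
  shows "profile_poly k 1 = 0"
proof -
  have "k = 0 \<or> k = 1 \<or> k = 2 \<or> k = 3 \<or> k = 4" using assms by auto
  then show ?thesis
    by (elim disjE)
       (simp_all add: profile_poly_def profile_coeff_def falling_def atMost_nat_numeral atMost_Suc
          lessThan_nat_numeral lessThan_Suc choose_5)
qed

text \<open>At the junction x = 1 the difference quotients of \<open>profile k\<close> are dominated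
  by those of \<open>profile_poly k\<close>, which tend to 0. This needs \<open>profile_poly\<close>
  of orders k and k + 1 to vanish there, whence \<open>k \<le> 3\<close>.\<close>

lemma DERIV_profile:
  assumes k: "k \<le> 3" and x: "x > 0"
  shows "(profile k has_real_derivative profile (Suc k) x) (at x)"
proof (cases "x = 1")
  case True
  have "(profile_poly k has_real_derivative 0) (at 1)"
    using DERIV_profile_poly[of 1 k] profile_poly_1[of "Suc k"] k by simp
  then have "((\<lambda>h. profile_poly k (1 + h) / h) \<longlongrightarrow> 0) (at 0)"
    using profile_poly_1[of k] k by (simp add: DERIV_def)
  then have "((\<lambda>h. (profile k (1 + h) - profile k 1) / h) \<longlongrightarrow> 0) (at 0)"
    by (rule tendsto_rabs_zero_cancel[OF tendsto_sandwich[OF _ _ tendsto_const tendsto_rabs_zero], rotated -1])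
       (auto simp: profile_def intro!: always_eventually)
  then show ?thesis using True by (simp add: DERIV_def profile_def)
next
  case False
  then consider "x < 1" | "x > 1" by linarith
  then show ?thesis
  proof cases
    case 1
    have "(profile k has_real_derivative profile_poly (Suc k) x) (at x)"
      by (rule has_field_derivative_transform_within_open[OF DERIV_profile_poly[OF x], where S="{..<1}"])
         (use 1 in \<open>auto simp: profile_def\<close>)
    with 1 show ?thesis by (simp add: profile_def)
  next
    case 2
    have "(profile k has_real_derivative 0) (at x)"
      by (rule has_field_derivative_transform_within_open[where S="{1<..}" and f="\<lambda>_. 0"])
         (use 2 in \<open>auto simp: profile_def\<close>)
    with 2 show ?thesis by (simp add: profile_def)
  qed
qed

lemma continuous_on_profile:
  assumes "k \<le> 4"
  shows "continuous_on {0<..} (profile k)"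
proof -
  have c: "continuous_on {0<..1} (profile_poly k)"
    by (rule DERIV_continuous_on[OF has_field_derivative_at_within[OF DERIV_profile_poly]]) auto
  have "continuous_on {0<..} (\<lambda>x. profile_poly k (min x 1))"
    by (intro continuous_on_compose2[OF c] continuous_intros) auto
  moreover have "profile_poly k (min x 1) = profile k x" for x
    using profile_poly_1[OF assms] by (auto simp: profile_def min_def)
  ultimately show ?thesis by simp
qed

text \<open>In three dimensions the Laplacian acts on functions of \<open>x = (\<phi> / R)\<^sup>2\<close>, up to the factor
  \<open>1 / R\<^sup>2\<close>, as \<open>4 (x - e\<^sup>2) D\<^sup>2 + 6 D\<close> with \<open>e = \<epsilon> / R\<close>. Its square, applied to the profile, is
  \<open>bilap_profile\<close>; \<open>far_kernel\<close> collects the positive powers of \<open>y = \<phi> / R\<close>, shifted by the constant that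
  makes it continuous at the cut-off \<open>y = 1\<close>.\<close>
definition bilap_profile :: "real \<Rightarrow> real \<Rightarrow> real" where
  "bilap_profile e x = 16 * (x - e\<^sup>2)\<^sup>2 * profile 4 x + 80 * (x - e\<^sup>2) * profile 3 x + 60 * profile 2 x"

definition far_kernel :: "real \<Rightarrow> real \<Rightarrow> real" where
  "far_kernel e y = (\<Sum>j=1..5.
      (16 * profile_coeff 4 j + 80 * profile_coeff 3 j + 60 * profile_coeff 2 j) * min y 1 ^ (8 * j - 3)
    - (32 * profile_coeff 4 j + 80 * profile_coeff 3 j) * e\<^sup>2 * min y 1 ^ (8 * j - 5)
    + 16 * profile_coeff 4 j * e ^ 4 * min y 1 ^ (8 * j - 7)) - 15 * e ^ 4"

lemma atLeastAtMost_1_5: "{1..5} = {1, 2, 3, 4, 5::nat}"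
  by auto

text \<open>The bilaplacian of the cut-off function vanishes at y = 1, so there the terms with
  \<open>j \<ge> 1\<close> must balance the contribution \<open>- 15 e^4\<close> of
  \<open>j = 0\<close>. The shift in the definition is that value, and \<open>min y 1\<close>
  freezes it beyond.\<close>

lemma far_kernel_eq_0:
  assumes "y \<ge> 1"
  shows "far_kernel e y = 0"
  unfolding far_kernel_def atLeastAtMost_1_5 using assms
  by (simp add: min_absorb2 profile_coeff_def falling_def choose_5
      lessThan_nat_numeral lessThan_Suc)

text \<open>The term \<open>j = 0\<close> is the regularized norm without cut-off and yields
  \<open>- 15 e^4 / y^7\<close>; the others are polynomial in y. Writing \<open>1 / y^7\<close> as 1
  plus \<open>1 / y^7 - 1\<close> moves a constant between the parts, so that each of them vanishes
  from y = 1 on.\<close>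

lemma bilap_profile_eq:
  assumes y: "y > 0"
  shows "bilap_profile e (y\<^sup>2) = far_kernel e y - 15 * e ^ 4 * max 0 (1 / y ^ 7 - 1)"
proof (cases "y < 1")
  case False
  then have "y ^ 7 \<ge> 1" "\<not> y\<^sup>2 < 1" by (simp_all add: not_less one_le_power)
  then have "1 / y ^ 7 \<le> 1" using y by (simp add: divide_le_eq)
  with False \<open>\<not> y\<^sup>2 < 1\<close> show ?thesis
    by (simp add: bilap_profile_def profile_def far_kernel_eq_0 max_absorb1)
next
  case True
  have y2: "y\<^sup>2 < 1" using True y by (simp add: power_less_one_iff)
  have pw: "(y\<^sup>2) powr (4 * real j + 1 / 2 - real k) = y ^ (8 * j + 1) / y ^ (2 * k)" for j k
  proof -
    have "(y\<^sup>2) powr (4 * real j + 1 / 2 - real k) = y powr (real (8 * j + 1) - real (2 * k))"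
      using y by (simp add: powr_powr flip: powr_numeral) (simp add: algebra_simps)
    also have "\<dots> = y ^ (8 * j + 1) / y ^ (2 * k)"
      using y by (subst powr_diff) (simp only: powr_realpow)
    finally show ?thesis .
  qed
  have split: "{..5::nat} = insert 0 {1..5}" by auto
  define c where "c = profile_coeff"
  have prof: "profile k (y\<^sup>2) = c k 0 * y / y ^ (2 * k) + (\<Sum>j=1..5. c k j * (y ^ (8 * j + 1) / y ^ (2 * k)))" for k
    using y2 by (simp add: profile_def profile_poly_def pw split c_def del: power_Suc power_add)
  have c0: "c 2 0 = - 1 / 4" "c 3 0 = 3 / 8" "c 4 0 = - 15 / 16"
    by (simp_all add: c_def profile_coeff_def falling_def lessThan_nat_numeral lessThan_Suc)
  \<comment> \<open>Because \<open>j \<ge> 1\<close>, the natural-number differences in these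
    exponents are exact.\<close>
  have p: "y ^ (8 * j + 1) / y ^ (2 * 4) = y ^ (8 * j - 7)"
    "y ^ (8 * j + 1) / y ^ (2 * 3) = y ^ (8 * j - 7) * y ^ 2"
    "y ^ (8 * j + 1) / y ^ (2 * 2) = y ^ (8 * j - 7) * y ^ 4"
    "y ^ (8 * j - 5) = y ^ (8 * j - 7) * y ^ 2" "y ^ (8 * j - 3) = y ^ (8 * j - 7) * y ^ 4" if "j \<ge> 1" for j
  proof -
    define m where "m = 8 * j - 7"
    have m: "8 * j + 1 = m + 8" "8 * j - 5 = m + 2" "8 * j - 3 = m + 4" "8 * j - 7 = m"
      using that by (auto simp: m_def)
    have y8: "y ^ 8 / y ^ (2 * 4) = 1" "y ^ 8 / y ^ (2 * 3) = y\<^sup>2" "y ^ 8 / y ^ (2 * 2) = y ^ 4"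
      using y by (simp_all add: power_diff[symmetric])
    show "y ^ (8 * j + 1) / y ^ (2 * 4) = y ^ (8 * j - 7)"
      "y ^ (8 * j + 1) / y ^ (2 * 3) = y ^ (8 * j - 7) * y ^ 2"
      "y ^ (8 * j + 1) / y ^ (2 * 2) = y ^ (8 * j - 7) * y ^ 4"
      "y ^ (8 * j - 5) = y ^ (8 * j - 7) * y ^ 2" "y ^ (8 * j - 3) = y ^ (8 * j - 7) * y ^ 4"
      unfolding m power_add times_divide_eq_right[symmetric] y8 by simp_all
  qed
  have key: "16 * (y\<^sup>2 - e\<^sup>2)\<^sup>2 * (a * T) + 80 * (y\<^sup>2 - e\<^sup>2) * (b * (T * y\<^sup>2)) + 60 * (d * (T * y ^ 4))
      = (16 * a + 80 * b + 60 * d) * (T * y ^ 4) - (32 * a + 80 * b) * e\<^sup>2 * (T * y\<^sup>2) + 16 * a * e ^ 4 * T"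
    for a b d T
    by (simp add: power2_eq_square power4_eq_xxxx algebra_simps)
  have "bilap_profile e (y\<^sup>2) =
     (16 * (y\<^sup>2 - e\<^sup>2)\<^sup>2 * (c 4 0 * y / y ^ (2 * 4)) + 80 * (y\<^sup>2 - e\<^sup>2) * (c 3 0 * y / y ^ (2 * 3)) + 60 * (c 2 0 * y / y ^ (2 * 2)))
     + (\<Sum>j=1..5. 16 * (y\<^sup>2 - e\<^sup>2)\<^sup>2 * (c 4 j * (y ^ (8 * j + 1) / y ^ (2 * 4)))
         + 80 * (y\<^sup>2 - e\<^sup>2) * (c 3 j * (y ^ (8 * j + 1) / y ^ (2 * 3))) + 60 * (c 2 j * (y ^ (8 * j + 1) / y ^ (2 * 2))))"
    unfolding bilap_profile_def prof by (simp only: sum.distrib sum_distrib_left distrib_left add_ac)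
  \<comment> \<open>For the plain square root the coefficients of \<open>e^0\<close> and
    \<open>e^2\<close> cancel, -15 + 30 - 15 = 0 and -30 + 30 = 0, which reflects that the norm is
    biharmonic off the origin. Only \<open>e^4\<close> survives.\<close>
  also have "(16 * (y\<^sup>2 - e\<^sup>2)\<^sup>2 * (c 4 0 * y / y ^ (2 * 4)) + 80 * (y\<^sup>2 - e\<^sup>2) * (c 3 0 * y / y ^ (2 * 3)) + 60 * (c 2 0 * y / y ^ (2 * 2)))
     = - 15 * e ^ 4 / y ^ 7"
  proof -
    have "16 * (y\<^sup>2 - e\<^sup>2)\<^sup>2 * (a * y) + 80 * (y\<^sup>2 - e\<^sup>2) * (b * (y * y\<^sup>2)) + 60 * (d * (y * y ^ 4))
      = (16 * a + 80 * b + 60 * d) * (y * y ^ 4) - (32 * a + 80 * b) * e\<^sup>2 * (y * y\<^sup>2) + 16 * a * e ^ 4 * y"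
      for a b d by (rule key)
    from this[of "- 15 / 16" "3 / 8" "- 1 / 4"]
    have "16 * (y\<^sup>2 - e\<^sup>2)\<^sup>2 * (- 15 / 16 * y) + 80 * (y\<^sup>2 - e\<^sup>2) * (3 / 8 * (y * y\<^sup>2)) + 60 * (- 1 / 4 * (y * y ^ 4))
      = - 15 * e ^ 4 * y" by simp
    moreover have "16 * (y\<^sup>2 - e\<^sup>2)\<^sup>2 * (- 15 / 16 * y / y ^ (2 * 4)) + 80 * (y\<^sup>2 - e\<^sup>2) * (3 / 8 * y / y ^ (2 * 3)) + 60 * (- 1 / 4 * y / y ^ (2 * 2))
      = (16 * (y\<^sup>2 - e\<^sup>2)\<^sup>2 * (- 15 / 16 * y) + 80 * (y\<^sup>2 - e\<^sup>2) * (3 / 8 * (y * y\<^sup>2)) + 60 * (- 1 / 4 * (y * y ^ 4))) / y ^ 8"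
    proof -
      have "1 / y ^ (2 * 4) = 1 / y ^ 8" "1 / y ^ (2 * 3) = y\<^sup>2 / y ^ 8" "1 / y ^ (2 * 2) = y ^ 4 / y ^ 8"
        using y by (simp_all add: power_diff[symmetric] field_simps flip: power_add)
      then have "a / y ^ (2 * 4) = a / y ^ 8" "a / y ^ (2 * 3) = a * y\<^sup>2 / y ^ 8" "a / y ^ (2 * 2) = a * y ^ 4 / y ^ 8" for a
        by (metis mult.right_neutral times_divide_eq_right)+
      then show ?thesis by (simp add: add_divide_distrib diff_divide_distrib mult.assoc)
    qed
    moreover have "- 15 * e ^ 4 * y / y ^ 8 = - 15 * e ^ 4 / y ^ 7"
      using y by (simp add: eval_nat_numeral)
    ultimately show ?thesis unfolding c0 by simp
  qed
  also have "(\<Sum>j=1..5. 16 * (y\<^sup>2 - e\<^sup>2)\<^sup>2 * (c 4 j * (y ^ (8 * j + 1) / y ^ (2 * 4)))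
         + 80 * (y\<^sup>2 - e\<^sup>2) * (c 3 j * (y ^ (8 * j + 1) / y ^ (2 * 3))) + 60 * (c 2 j * (y ^ (8 * j + 1) / y ^ (2 * 2))))
     = far_kernel e y + 15 * e ^ 4"
  proof -
    have "min y 1 = y" using True by simp
    then show ?thesis
      unfolding far_kernel_def c_def[symmetric] diff_add_cancel
    proof (intro sum.cong refl)
      fix j :: nat assume "j \<in> {1..5}"
      then have "j \<ge> 1" by simp
      show "16 * (y\<^sup>2 - e\<^sup>2)\<^sup>2 * (c 4 j * (y ^ (8 * j + 1) / y ^ (2 * 4)))
         + 80 * (y\<^sup>2 - e\<^sup>2) * (c 3 j * (y ^ (8 * j + 1) / y ^ (2 * 3))) + 60 * (c 2 j * (y ^ (8 * j + 1) / y ^ (2 * 2)))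
        = (16 * c 4 j + 80 * c 3 j + 60 * c 2 j) * min y 1 ^ (8 * j - 3)
          - (32 * c 4 j + 80 * c 3 j) * e\<^sup>2 * min y 1 ^ (8 * j - 5) + 16 * c 4 j * e ^ 4 * min y 1 ^ (8 * j - 7)"
        unfolding \<open>min y 1 = y\<close> p[OF \<open>j \<ge> 1\<close>] by (rule key)
    qed
  qed
  finally have "bilap_profile e (y\<^sup>2) = - 15 * e ^ 4 / y ^ 7 + (far_kernel e y + 15 * e ^ 4)" .
  moreover have "1 / y ^ 7 \<ge> 1" using y True by (simp add: power_le_one)
  ultimately show ?thesis by (simp add: max_absorb2 algebra_simps)
qed

text \<open>The kernel is a polynomial in \<open>min y 1\<close>, which lies in [0, 1], with
  exponents at most \<open>8 * j\<close>. As \<open>e\<close> enters only with nonnegative powers,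
  one constant serves all \<open>e\<close> in [0, 1]; this matters because
  \<open>e = \<epsilon> / R\<close> varies as \<open>R\<close> grows.\<close>

lemma far_kernel_lipschitz:
  obtains L where "L \<ge> 0" "\<And>e y y'. \<lbrakk>0 \<le> e; e \<le> 1; y \<ge> 0; y' \<ge> 0\<rbrakk> \<Longrightarrow>
    \<bar>far_kernel e y - far_kernel e y'\<bar> \<le> L * \<bar>y - y'\<bar>"
proof -
  define A B C where "A j = 16 * profile_coeff 4 j + 80 * profile_coeff 3 j + 60 * profile_coeff 2 j"
    and "B j = 32 * profile_coeff 4 j + 80 * profile_coeff 3 j" and "C j = 16 * profile_coeff 4 j" for j
  define L where "L = (\<Sum>j=1..5. (\<bar>A j\<bar> + \<bar>B j\<bar> + \<bar>C j\<bar>) * real (8 * j))"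
  have "L \<ge> 0" unfolding L_def by (intro sum_nonneg) auto
  moreover have "\<bar>far_kernel e y - far_kernel e y'\<bar> \<le> L * \<bar>y - y'\<bar>"
    if e: "0 \<le> e" "e \<le> 1" and y: "y \<ge> 0" "y' \<ge> 0" for e y y'
  proof -
    define s s' where "s = min y 1" and "s' = min y' 1"
    have s: "norm s \<le> 1" "norm s' \<le> 1" "\<bar>s - s'\<bar> \<le> \<bar>y - y'\<bar>"
      using y by (auto simp: s_def s'_def)
    have pw: "\<bar>c * (s ^ n - s' ^ n)\<bar> \<le> d * (real m * \<bar>y - y'\<bar>)" if "n \<le> m" "\<bar>c\<bar> \<le> d" for n m c d
    proof -
      have "\<bar>s ^ n - s' ^ n\<bar> \<le> real n * \<bar>s - s'\<bar>" using norm_power_diff[OF s(1,2), of n] by simp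
      also have "\<dots> \<le> real m * \<bar>y - y'\<bar>" using that s(3) by (intro mult_mono) auto
      finally show ?thesis unfolding abs_mult using that by (intro mult_mono) auto
    qed
    have e': "e\<^sup>2 \<le> 1" "e ^ 4 \<le> 1" using e by (auto intro: power_le_one)
    have eq: "far_kernel e y - far_kernel e y' = (\<Sum>j=1..5. A j * (s ^ (8 * j - 3) - s' ^ (8 * j - 3))
        + (- B j * e\<^sup>2) * (s ^ (8 * j - 5) - s' ^ (8 * j - 5)) + (C j * e ^ 4) * (s ^ (8 * j - 7) - s' ^ (8 * j - 7)))"
      unfolding far_kernel_def s_def[symmetric] s'_def[symmetric] A_def B_def C_def
      by (simp add: sum_subtractf[symmetric] algebra_simps)
    have "\<bar>far_kernel e y - far_kernel e y'\<bar> \<le> (\<Sum>j=1..5. (\<bar>A j\<bar> + \<bar>B j\<bar> + \<bar>C j\<bar>) * (real (8 * j) * \<bar>y - y'\<bar>))"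
      unfolding eq
    proof (rule order_trans[OF sum_abs sum_mono])
      fix j
      have tri: "\<bar>x + y + z\<bar> \<le> (a + b + c) * d" if "\<bar>x\<bar> \<le> a * d" "\<bar>y\<bar> \<le> b * d" "\<bar>z\<bar> \<le> c * d"
        for x y z a b c d :: real
        using that unfolding distrib_right by linarith
      have "\<bar>A j * (s ^ (8 * j - 3) - s' ^ (8 * j - 3))\<bar> \<le> \<bar>A j\<bar> * (real (8 * j) * \<bar>y - y'\<bar>)"
        by (rule pw) auto
      moreover have "\<bar>(- B j * e\<^sup>2) * (s ^ (8 * j - 5) - s' ^ (8 * j - 5))\<bar> \<le> \<bar>B j\<bar> * (real (8 * j) * \<bar>y - y'\<bar>)"
        by (rule pw) (use e' in \<open>auto simp: abs_mult mult_left_le\<close>)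
      moreover have "\<bar>(C j * e ^ 4) * (s ^ (8 * j - 7) - s' ^ (8 * j - 7))\<bar> \<le> \<bar>C j\<bar> * (real (8 * j) * \<bar>y - y'\<bar>)"
        by (rule pw) (use e' in \<open>auto simp: abs_mult mult_left_le\<close>)
      ultimately show "\<bar>A j * (s ^ (8 * j - 3) - s' ^ (8 * j - 3))
        + (- B j * e\<^sup>2) * (s ^ (8 * j - 5) - s' ^ (8 * j - 5)) + (C j * e ^ 4) * (s ^ (8 * j - 7) - s' ^ (8 * j - 7))\<bar>
        \<le> (\<bar>A j\<bar> + \<bar>B j\<bar> + \<bar>C j\<bar>) * (real (8 * j) * \<bar>y - y'\<bar>)"
        by (rule tri)
    qed
    also have "\<dots> = L * \<bar>y - y'\<bar>"
      by (simp add: L_def sum_distrib_right mult.assoc)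
    finally show ?thesis .
  qed
  ultimately show ?thesis by (rule that)
qed

section \<open>The regularized norm and even reflection\<close>

definition reflect :: "'a \<times> real \<Rightarrow> 'a \<times> real" where
  "reflect p = (fst p, - snd p)"

definition reg_norm :: "real \<Rightarrow> 'a::real_normed_vector \<Rightarrow> real" where
  "reg_norm \<epsilon> z = sqrt ((norm z)\<^sup>2 + \<epsilon>\<^sup>2)"

lemma reg_norm_sq: "(reg_norm \<epsilon> z)\<^sup>2 = (norm z)\<^sup>2 + \<epsilon>\<^sup>2"
  by (simp add: reg_norm_def)

lemma reg_norm_ge: "norm z \<le> reg_norm \<epsilon> z" "\<bar>\<epsilon>\<bar> \<le> reg_norm \<epsilon> z"
  by (auto simp: reg_norm_def intro: real_le_rsqrt)

lemma reg_norm_pos: "\<epsilon> > 0 \<Longrightarrow> reg_norm \<epsilon> z > 0"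
  using reg_norm_ge(2)[of \<epsilon> z] by linarith

lemma continuous_on_reg_norm [continuous_intros]:
  "continuous_on S g \<Longrightarrow> continuous_on S (\<lambda>x. reg_norm \<epsilon> (g x))"
  unfolding reg_norm_def by (intro continuous_intros)

section \<open>Even reflection across the boundary plane\<close>

lemma norm_reflect_diff:
  fixes X P :: "'a::euclidean_space \<times> real"
  shows "norm (reflect X - P) = norm (X - reflect P)"
proof -
  have "norm (- snd X - snd P) = norm (snd X + snd P)"
    by (metis minus_add_distrib norm_minus_cancel uminus_add_conv_diff add.commute diff_conv_add_uminus)
  then show ?thesis by (simp add: reflect_def norm_prod_def)
qed

lemma norm_boundary_diff_reflect:
  fixes P :: "'a::euclidean_space \<times> real"
  shows "norm ((y, 0) - reflect P) = norm ((y, 0) - P)"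
  using norm_reflect_diff[of "(y, 0)" P] by (simp add: reflect_def)

lemma reflect_reflect [simp]: "reflect (reflect p) = p"
  by (simp add: reflect_def)

lemma continuous_on_reflect [continuous_intros]:
  "continuous_on S g \<Longrightarrow> continuous_on S (\<lambda>x. reflect (g x))"
  unfolding reflect_def by (intro continuous_intros)

lemma borel_measurable_reflect [measurable]:
  "(reflect :: 'a::euclidean_space \<times> real \<Rightarrow> _) \<in> borel_measurable borel"
  using continuous_on_reflect[OF continuous_on_id] by (intro borel_measurable_continuous_onI) auto

lemma distr_lborel_reflect:
  "distr lborel borel (reflect :: 'a::euclidean_space \<times> real \<Rightarrow> _) = lborel"
proof -
  have "lborel \<Otimes>\<^sub>M lborel = distr lborel borel (\<lambda>x::'a. x) \<Otimes>\<^sub>M distr lborel borel (uminus :: real \<Rightarrow> real)"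
    by (simp add: lborel_distr_uminus distr_id2)
  also have "\<dots> = distr (lborel \<Otimes>\<^sub>M lborel) (borel \<Otimes>\<^sub>M borel) (\<lambda>(x::'a, y::real). (x, - y))"
    by (rule pair_measure_distr) (auto simp: lborel_distr_uminus lborel.sigma_finite_measure_axioms)
  finally have "lborel = distr lborel borel (\<lambda>(x::'a, y::real). (x, - y))"
    by (simp add: lborel_prod borel_prod)
  also have "(\<lambda>(x::'a, y::real). (x, - y)) = reflect"
    by (auto simp: reflect_def)
  finally show ?thesis by (rule sym)
qed

lemma closed_half_space_borel [measurable]:
  "{p :: 'a::euclidean_space \<times> real. snd p \<ge> 0} \<in> sets borel"
  by (intro borel_closed closed_Collect_le continuous_intros)

lemma integrable_half_space:
  fixes h :: "'a::euclidean_space \<times> real \<Rightarrow> real"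
  assumes "integrable lborel h"
  shows "integrable lborel (\<lambda>X. indicator {p. snd p \<ge> 0} X * h X)"
  using integrable_real_mult_indicator[OF _ assms, of "{p. snd p \<ge> 0}"] closed_half_space_borel
  by (simp add: mult.commute)

text \<open>Used to merge half-space integrals with the two centres \<open>P\<close> and
  \<open>reflect P\<close> into one integral of the even extension with the single centre
  \<open>P\<close>.\<close>

lemma integral_fold_half_space:
  fixes h :: "'a::euclidean_space \<times> real \<Rightarrow> real"
  assumes h: "integrable lborel h"
  shows "(\<integral>X. h X \<partial>lborel) = (\<integral>X. indicator {p. snd p \<ge> 0} X * (h X + h (reflect X)) \<partial>lborel)"
proof -
  let ?H = "{p :: 'a \<times> real. snd p \<ge> 0}"
  note [measurable] = borel_measurable_integrable[OF h]
  have hr: "integrable lborel (\<lambda>X. h (reflect X))"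
    using h integrable_distr_eq[of reflect lborel borel h] by (simp add: distr_lborel_reflect)
  have flip: "(\<integral>X. g (reflect X) \<partial>lborel) = (\<integral>X. g X \<partial>lborel)"
    if "g \<in> borel_measurable borel" for g :: "'a \<times> real \<Rightarrow> real"
    using integral_distr[of reflect lborel borel g] that by (simp add: distr_lborel_reflect)
  have "(\<integral>X. h X \<partial>lborel) = (\<integral>X. indicator ?H X * h X + indicator ?H (reflect X) * h X \<partial>lborel)"
  proof (rule integral_cong_AE)
    \<comment> \<open>The plane t = 0 is counted in both halves, but it is a null set.\<close>
    have "AE X::'a \<times> real in lborel. snd X \<noteq> 0"
      using AE_lborel_inner_neq[of "(0, 1) :: 'a \<times> real" 0] by (simp add: Basis_prod_def inner_prod_def)
    then show "AE X in lborel. h X = indicator ?H X * h X + indicator ?H (reflect X) * h X"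
      by eventually_elim (auto simp: indicator_def reflect_def)
  qed auto
  also have "\<dots> = (\<integral>X. indicator ?H X * h X \<partial>lborel) + (\<integral>X. indicator ?H (reflect X) * h X \<partial>lborel)"
  proof (rule Bochner_Integration.integral_add[OF integrable_half_space[OF h]])
    have "integrable lborel (\<lambda>X. indicator ?H (reflect X) * h (reflect (reflect X)))"
      using integrable_half_space[OF hr] integrable_distr_eq[of reflect lborel borel "\<lambda>X. indicator ?H X * h (reflect X)"]
      by (simp add: distr_lborel_reflect)
    then show "integrable lborel (\<lambda>X. indicator ?H (reflect X) * h X)" by simp
  qed
  also have "(\<integral>X. indicator ?H (reflect X) * h X \<partial>lborel) = (\<integral>X. indicator ?H X * h (reflect X) \<partial>lborel)"
    using flip[of "\<lambda>X. indicator ?H X * h (reflect X)"] by simp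
  also have "(\<integral>X. indicator ?H X * h X \<partial>lborel) + \<dots> = (\<integral>X. indicator ?H X * (h X + h (reflect X)) \<partial>lborel)"
    using integrable_half_space[OF h] integrable_half_space[OF hr] by (simp add: distrib_left)
  finally show ?thesis .
qed

text \<open>Adding the reflected test function cancels the boundary term that contains \<open>v\<close> itself.\<close>
lemma Green_reflected_radial:
  fixes v :: "R3 \<Rightarrow> real" and P :: R3 and H H' H'' :: "real \<Rightarrow> real"
  assumes v: "smooth v" and \<epsilon>: "\<epsilon> > 0" and R: "R > 0"
    and H: "\<And>x. x > 0 \<Longrightarrow> (H has_real_derivative H' x) (at x)"
      "\<And>x. x > 0 \<Longrightarrow> (H' has_real_derivative H'' x) (at x)"
    and cont: "continuous_on {0<..} H''" and zero: "\<And>x. x \<ge> 1 \<Longrightarrow> H x = 0"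
  defines "q \<equiv> \<lambda>P X. ((norm (X - P))\<^sup>2 + \<epsilon>\<^sup>2) / R\<^sup>2"
  defines "L \<equiv> \<lambda>x. 4 * (x - (\<epsilon> / R)\<^sup>2) * H'' x + 6 * H' x"
  shows "(\<integral>X. indicator {p. snd p \<ge> 0} X *
      (v X * ((L (q P X) + L (q (reflect P) X)) / R\<^sup>2) - (H (q P X) + H (q (reflect P) X)) * laplacian v X) \<partial>lborel)
    = (\<integral>y. 2 * H (q P (y, 0)) * pderiv_dir (0, 1) v (y, 0) \<partial>lborel)"
proof -
  define d where "d Q X b = 2 * ((X - Q) \<bullet> b) / R\<^sup>2" for Q X b :: R3
  have contH: "continuous_on {0<..} H" "continuous_on {0<..} H'"
    by (rule DERIV_continuous_on[OF has_field_derivative_at_within[OF H(1)]]; simp)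
       (rule DERIV_continuous_on[OF has_field_derivative_at_within[OF H(2)]]; simp)
  have cq: "continuous_on UNIV (\<lambda>X. H (q Q X))" "continuous_on UNIV (\<lambda>X. H' (q Q X))"
    "continuous_on UNIV (\<lambda>X. H'' (q Q X))" for Q :: R3
    using continuous_on_radial[OF contH(1) \<epsilon> R] continuous_on_radial[OF contH(2) \<epsilon> R]
      continuous_on_radial[OF cont \<epsilon> R] by (auto simp: q_def)
  have cd: "continuous_on UNIV (\<lambda>X. d Q X b)" for Q b
    unfolding d_def using R by (intro continuous_intros) auto
  have "(\<integral>X. indicator {p. snd p \<ge> 0} X *
      (v X * (\<Sum>b\<in>Basis. (H'' (q P X) * (d P X b)\<^sup>2 + H' (q P X) * (2 / R\<^sup>2))
            + (H'' (q (reflect P) X) * (d (reflect P) X b)\<^sup>2 + H' (q (reflect P) X) * (2 / R\<^sup>2)))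
        - (H (q P X) + H (q (reflect P) X)) * laplacian v X) \<partial>lborel)
    = - (\<integral>y. v (y, 0) * (H' (q P (y, 0)) * d P (y, 0) (0, 1) + H' (q (reflect P) (y, 0)) * d (reflect P) (y, 0) (0, 1))
        - (H (q P (y, 0)) + H (q (reflect P) (y, 0))) * pderiv_dir (0, 1) v (y, 0) \<partial>lborel)"
  proof (rule Green_half_space[OF v, where M = "norm P + R"])
    fix b :: R3 assume b: "b \<in> Basis"
    show "has_pderiv b (\<lambda>X. H (q P X) + H (q (reflect P) X))
        (\<lambda>X. H' (q P X) * d P X b + H' (q (reflect P) X) * d (reflect P) X b)"
      unfolding q_def d_def by (intro has_pderiv_add has_pderiv_radial H \<epsilon> R)
    show "has_pderiv b (\<lambda>X. H' (q P X) * d P X b + H' (q (reflect P) X) * d (reflect P) X b)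
       (\<lambda>X. (H'' (q P X) * (d P X b)\<^sup>2 + H' (q P X) * (2 / R\<^sup>2))
            + (H'' (q (reflect P) X) * (d (reflect P) X b)\<^sup>2 + H' (q (reflect P) X) * (2 / R\<^sup>2)))"
      unfolding q_def d_def by (intro has_pderiv_add has_pderiv_radial2 H \<epsilon> R b)
    show "continuous_on UNIV (\<lambda>X. H' (q P X) * d P X b + H' (q (reflect P) X) * d (reflect P) X b)"
      by (intro continuous_intros cq cd)
    show "continuous_on UNIV (\<lambda>X. (H'' (q P X) * (d P X b)\<^sup>2 + H' (q P X) * (2 / R\<^sup>2))
            + (H'' (q (reflect P) X) * (d (reflect P) X b)\<^sup>2 + H' (q (reflect P) X) * (2 / R\<^sup>2)))"
      by (intro continuous_intros cq cd)
  next
    show "continuous_on UNIV (\<lambda>X. H (q P X) + H (q (reflect P) X))"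
      by (intro continuous_intros cq)
    fix X :: R3 assume X: "norm X > norm P + R"
    have "H (q Q X) = 0" if "norm Q = norm P" for Q
    proof (rule zero)
      have "norm (X - Q) > R" using X norm_triangle_ineq2[of X Q] that by linarith
      then have "R\<^sup>2 \<le> (norm (X - Q))\<^sup>2" using R by (intro power_mono) auto
      then have "R\<^sup>2 \<le> (norm (X - Q))\<^sup>2 + \<epsilon>\<^sup>2" by (rule add_increasing2[OF zero_le_power2])
      then show "q Q X \<ge> 1" using R by (simp add: q_def)
    qed
    moreover have "norm (reflect P) = norm P" by (simp add: reflect_def norm_prod_def)
    ultimately show "H (q P X) + H (q (reflect P) X) = 0" by simp
  qed
  moreover have "(\<Sum>b\<in>Basis. (H'' (q P X) * (d P X b)\<^sup>2 + H' (q P X) * (2 / R\<^sup>2))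
            + (H'' (q (reflect P) X) * (d (reflect P) X b)\<^sup>2 + H' (q (reflect P) X) * (2 / R\<^sup>2)))
      = (L (q P X) + L (q (reflect P) X)) / R\<^sup>2" for X
  proof -
    have "(\<Sum>b\<in>Basis. H'' (q Q X) * (d Q X b)\<^sup>2 + H' (q Q X) * (2 / R\<^sup>2)) = L (q Q X) / R\<^sup>2" for Q
      unfolding d_def L_def q_def using laplacian_radial_eq[OF R, of _ X Q _ \<epsilon>] by simp
    then show ?thesis
      by (subst sum.distrib[of "\<lambda>b. H'' (q P X) * (d P X b)\<^sup>2 + H' (q P X) * (2 / R\<^sup>2)"])
         (simp only: add_divide_distrib)
  qed
  \<comment> \<open>Boundary points are equidistant from the two centres, which lie on opposite
    sides: the values of the two summands double and their normal derivatives cancel.\<close>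
  moreover have "q (reflect P) (y, 0) = q P (y, 0)" for y
    by (simp add: q_def norm_boundary_diff_reflect)
  moreover have "d (reflect P) (y, 0) (0, 1) = - d P (y, 0) (0, 1)" for y
    by (simp add: d_def reflect_def inner_prod_def)
  ultimately show ?thesis by simp
qed

text \<open>Green's identity is used twice. For \<open>u\<close> and the Laplacian of the test
  function the boundary term is zero by \<open>bc1\<close>, and one Laplacian passes to
  \<open>u\<close>. For \<open>laplacian u\<close> and the test function itself the interior term is
  zero by biharmonicity, and \<open>bc2\<close> brings in \<open>f\<close>.\<close>

lemma half_space_identity:
  fixes u U :: "R3 \<Rightarrow> real" and f :: "real^2 \<Rightarrow> real" and P :: R3
  assumes u: "smooth u"
    and biharm: "\<And>x t. t > 0 \<Longrightarrow> laplacian (laplacian u) (x, t) = 0"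
    and bc1: "\<And>x. pderiv_dir (0, 1) u (x, 0) = 0"
    and bc2: "\<And>x. pderiv_dir (0, 1) (laplacian u) (x, 0) = - f x"
    and \<epsilon>: "\<epsilon> > 0" and R: "R > 0"
  defines "U \<equiv> \<lambda>X. u (fst X, \<bar>snd X\<bar>)"
  shows "15 * \<epsilon> ^ 4 * (\<integral>X. U X * max 0 (1 / reg_norm \<epsilon> (X - P) ^ 7 - 1 / R ^ 7) \<partial>lborel)
      - (\<integral>X. U X * far_kernel (\<epsilon> / R) (reg_norm \<epsilon> (X - P) / R) \<partial>lborel) / R ^ 3
    = 2 * (\<integral>y. f y * (R * profile 0 ((reg_norm \<epsilon> ((y, 0) - P) / R)\<^sup>2)) \<partial>lborel)"
proof -
  let ?H = "{p :: R3. snd p \<ge> 0}"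
  define q where "q Q X = ((norm (X - Q))\<^sup>2 + \<epsilon>\<^sup>2) / R\<^sup>2" for Q X :: R3
  define e where "e = \<epsilon> / R"
  \<comment> \<open>Up to the factor \<open>1 / R^2\<close>, \<open>G\<close> is the Laplacian of
    the profile in the radial variable. \<open>G'\<close> and \<open>G''\<close> are its
    derivatives, with 10 = 6 + 4 and 14 = 10 + 4 from the product rule.\<close>
  define G where "G x = 4 * (x - e\<^sup>2) * profile 2 x + 6 * profile 1 x" for x
  define G' where "G' x = 4 * (x - e\<^sup>2) * profile 3 x + 10 * profile 2 x" for x
  define G'' where "G'' x = 4 * (x - e\<^sup>2) * profile 4 x + 14 * profile 3 x" for x
  have dp: "(profile 0 has_real_derivative profile 1 x) (at x)" "(profile 1 has_real_derivative profile 2 x) (at x)"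
    "(profile 2 has_real_derivative profile 3 x) (at x)" "(profile 3 has_real_derivative profile 4 x) (at x)" if "x > 0" for x
  proof -
    have D: "(profile k has_real_derivative profile m x) (at x)" if "m = Suc k" "k \<le> 3" for k m
      using DERIV_profile[OF that(2) \<open>x > 0\<close>] that(1) by simp
    show "(profile 0 has_real_derivative profile 1 x) (at x)" "(profile 1 has_real_derivative profile 2 x) (at x)"
      "(profile 2 has_real_derivative profile 3 x) (at x)" "(profile 3 has_real_derivative profile 4 x) (at x)"
      by (rule D; simp)+
  qed
  have cp: "continuous_on {0<..} (profile k)" if "k \<le> 4" for k
    using that by (rule continuous_on_profile)
  have p0: "profile k x = 0" if "x \<ge> 1" for k x using that by (simp add: profile_def)
  have G: "(G has_real_derivative G' x) (at x)" "(G' has_real_derivative G'' x) (at x)" if "x > 0" for x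
    unfolding G_def[abs_def] G'_def[abs_def] G''_def using that
    by (auto intro!: derivative_eq_intros dp dp[unfolded One_nat_def] simp: algebra_simps)
  have G2: "continuous_on {0<..} G''"
    unfolding G''_def[abs_def] by (intro continuous_intros cp) auto
  have bil: "4 * (x - e\<^sup>2) * G'' x + 6 * G' x = bilap_profile e x" for x
    by (simp add: G''_def G'_def bilap_profile_def power2_eq_square algebra_simps)
  \<comment> \<open>The equation is given for t > 0, while the half space of integration is closed;
    continuity extends it to t = 0.\<close>
  have lap0: "laplacian (laplacian u) X = 0" if "snd X \<ge> 0" for X
  proof (cases "snd X > 0")
    case True then show ?thesis using biharm[of "snd X" "fst X"] by simp
  next
    case False
    then have X: "X = (fst X, 0)" using that by (simp add: prod_eq_iff)
    have "continuous_on UNIV (\<lambda>t. laplacian (laplacian u) (fst X, t))"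
      by (intro continuous_on_compose2[OF smooth_continuous[OF smooth_laplacian[OF smooth_laplacian[OF u]]]] continuous_intros) auto
    then have "isCont (\<lambda>t. laplacian (laplacian u) (fst X, t)) 0"
      by (simp add: continuous_on_eq_continuous_at)
    then have "((\<lambda>t. laplacian (laplacian u) (fst X, t)) \<longlongrightarrow> laplacian (laplacian u) X) (at_right 0)"
      using X by (simp add: isCont_def filterlim_at_split)
    moreover have "\<forall>\<^sub>F t in at_right 0. laplacian (laplacian u) (fst X, t) = 0"
      using biharm by (auto simp: eventually_at_right_less eventually_at_filter intro!: always_eventually)
    ultimately have "((\<lambda>t::real. 0) \<longlongrightarrow> laplacian (laplacian u) X) (at_right 0)"
      by (rule Lim_transform_eventually)
    then show ?thesis
      using tendsto_unique[OF trivial_limit_at_right_real tendsto_const] by fastforce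
  qed
  have far: "q Q X \<ge> 1" if "norm X > norm Q + R" for Q X
  proof -
    have "norm (X - Q) > R" using that norm_triangle_ineq2[of X Q] by linarith
    then have "R\<^sup>2 \<le> (norm (X - Q))\<^sup>2" using R by (intro power_mono) auto
    then have "R\<^sup>2 \<le> (norm (X - Q))\<^sup>2 + \<epsilon>\<^sup>2" by (rule add_increasing2[OF zero_le_power2])
    then show "q Q X \<ge> 1" using R by (simp add: q_def)
  qed
  have cont_q: "continuous_on UNIV (\<lambda>X. F (q Q X))" if "continuous_on {0<..} F"
    for F :: "real \<Rightarrow> real" and Q
    unfolding q_def using continuous_on_radial[OF that \<epsilon> R] .
  have int: "integrable lborel (\<lambda>X. w X * F (q Q X))"
    if "continuous_on {0<..} F" "\<And>x. x \<ge> 1 \<Longrightarrow> F x = 0" "continuous_on UNIV w"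
    for F :: "real \<Rightarrow> real" and Q w
  proof (rule integrable_compact_support)
    show "continuous_on UNIV (\<lambda>X. w X * F (q Q X))"
      by (rule continuous_on_mult[OF that(3) cont_q[OF that(1)]])
    show "w X * F (q Q X) = 0" if "norm X > norm Q + R" for X
      using far[OF that] \<open>\<And>x. x \<ge> 1 \<Longrightarrow> F x = 0\<close> by simp
  qed
  have cG: "continuous_on {0<..} G" "continuous_on {0<..} (bilap_profile e)"
    unfolding G_def[abs_def] bilap_profile_def[abs_def] by (intro continuous_intros cp; simp)+
  have zG: "G x = 0" "bilap_profile e x = 0" if "x \<ge> 1" for x
    using that by (simp_all add: G_def bilap_profile_def p0)
  note cu = smooth_continuous[OF u] smooth_continuous[OF smooth_laplacian[OF u]]
  define B where "B X = bilap_profile e (q P X) + bilap_profile e (q (reflect P) X)" for X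
  define GG where "GG X = G (q P X) + G (q (reflect P) X)" for X
  have "(\<integral>X. indicator ?H X * (u X * (B X / R\<^sup>2) - GG X * laplacian u X) \<partial>lborel) = 0"
    using Green_reflected_radial[OF u \<epsilon> R G G2 zG(1), of P]
    by (simp add: bc1 B_def GG_def q_def bil e_def[symmetric] bil[symmetric])
  moreover have iB: "integrable lborel (\<lambda>X. u X * (B X / R\<^sup>2))"
    unfolding B_def add_divide_distrib distrib_left times_divide_eq_right
    by (intro Bochner_Integration.integrable_add integrable_divide int cG zG cu)
  moreover have iG: "integrable lborel (\<lambda>X. laplacian u X * GG X)"
    unfolding GG_def distrib_left
    by (intro Bochner_Integration.integrable_add int cG zG cu)
  ultimately have 1: "(\<integral>X. indicator ?H X * (u X * (B X / R\<^sup>2)) \<partial>lborel) = (\<integral>X. indicator ?H X * (laplacian u X * GG X) \<partial>lborel)"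
    using integrable_half_space[OF iB] integrable_half_space[OF iG]
    by (simp add: right_diff_distrib mult.commute[of "GG _"])
  have "(\<integral>X. indicator ?H X * (laplacian u X * (GG X / R\<^sup>2)) \<partial>lborel)
      = (\<integral>X. indicator ?H X * (laplacian u X * (GG X / R\<^sup>2)
          - (profile 0 (q P X) + profile 0 (q (reflect P) X)) * laplacian (laplacian u) X) \<partial>lborel)"
    by (intro Bochner_Integration.integral_cong refl) (auto simp: indicator_def lap0)
  also have "\<dots> = (\<integral>y. 2 * profile 0 (q P (y, 0)) * (- f y) \<partial>lborel)"
    using Green_reflected_radial[OF smooth_laplacian[OF u] \<epsilon> R dp(1,2) cp p0, of P]
    by (simp add: GG_def q_def G_def e_def bc2)
  also have "\<dots> = - 2 * (\<integral>y. f y * profile 0 (q P (y, 0)) \<partial>lborel)"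
    by (subst integral_mult_right_zero[symmetric]) (simp add: mult_ac)
  finally have 2: "(\<integral>X. indicator ?H X * (laplacian u X * GG X) \<partial>lborel) / R\<^sup>2
      = - 2 * (\<integral>y. f y * profile 0 (q P (y, 0)) \<partial>lborel)"
    by simp
  have cU: "continuous_on UNIV U"
    unfolding U_def by (intro continuous_on_compose2[OF cu(1)] continuous_intros) auto
  \<comment> \<open>\<open>U\<close> is even and reflecting X amounts to reflecting the centre, so
    folding the whole space onto the half space produces exactly \<open>B\<close>.\<close>
  have "(\<integral>X. U X * bilap_profile e (q P X) \<partial>lborel) = (\<integral>X. indicator ?H X * (u X * B X) \<partial>lborel)"
    by (subst integral_fold_half_space[OF int[OF cG(2) zG(2) cU]], simp,
        intro Bochner_Integration.integral_cong refl)
       (auto simp: indicator_def U_def B_def q_def norm_reflect_diff algebra_simps,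
        auto simp: reflect_def)
  also have "\<dots> = R\<^sup>2 * (\<integral>X. indicator ?H X * (u X * (B X / R\<^sup>2)) \<partial>lborel)"
    using R by simp
  also have "\<dots> = - 2 * R ^ 4 * (\<integral>y. f y * profile 0 (q P (y, 0)) \<partial>lborel)"
    using 1 2 R by (simp add: field_simps eval_nat_numeral)
  finally have 3: "(\<integral>X. U X * bilap_profile e (q P X) \<partial>lborel)
      = - 2 * R ^ 4 * (\<integral>y. f y * profile 0 (q P (y, 0)) \<partial>lborel)" .
  define y where "y X = reg_norm \<epsilon> (X - P) / R" for X
  have y: "y X > 0" "q P X = (y X)\<^sup>2" for X
    using R reg_norm_pos[OF \<epsilon>, of "X - P"] by (auto simp: y_def q_def power_divide reg_norm_sq)
  have cy: "continuous_on UNIV y"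
    unfolding y_def using R by (intro continuous_intros) auto
  have y1: "y X \<ge> 1" if "norm X > norm P + R" for X
    using far[OF that] y[of X] by (metis less_eq_real_def not_less one_power2 power_less_one_iff
        power2_eq_square power_strict_mono zero_le_one zero_less_numeral less_imp_le)
  have ifar: "integrable lborel (\<lambda>X. U X * far_kernel e (y X))"
  proof (rule integrable_compact_support[where M = "norm P + R"])
    show "continuous_on UNIV (\<lambda>X. U X * far_kernel e (y X))"
      unfolding far_kernel_def by (intro continuous_intros cU cy)
  qed (simp add: far_kernel_eq_0 y1)
  have inear: "integrable lborel (\<lambda>X. U X * max 0 (1 / y X ^ 7 - 1))"
  proof (rule integrable_compact_support[where M = "norm P + R"])
    show "continuous_on UNIV (\<lambda>X. U X * max 0 (1 / y X ^ 7 - 1))"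
      using y(1) by (intro continuous_intros cU cy) (auto simp: less_imp_neq[symmetric])
    show "U X * max 0 (1 / y X ^ 7 - 1) = 0" if "norm X > norm P + R" for X
    proof -
      have "1 / y X ^ 7 \<le> 1" using one_le_power[OF y1[OF that], of 7] y(1)[of X] by (simp add: divide_le_eq)
      then show ?thesis by (simp add: max_absorb1)
    qed
  qed
  have "(\<integral>X. U X * bilap_profile e (q P X) \<partial>lborel)
      = (\<integral>X. U X * far_kernel e (y X) - 15 * e ^ 4 * (U X * max 0 (1 / y X ^ 7 - 1)) \<partial>lborel)"
    unfolding y(2) bilap_profile_eq[OF y(1)] by (simp add: algebra_simps)
  also have "\<dots> = (\<integral>X. U X * far_kernel e (y X) \<partial>lborel) - 15 * e ^ 4 * (\<integral>X. U X * max 0 (1 / y X ^ 7 - 1) \<partial>lborel)"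
    using ifar inear by simp
  also have "(\<integral>X. U X * max 0 (1 / y X ^ 7 - 1) \<partial>lborel)
      = (\<integral>X. R ^ 7 * (U X * max 0 (1 / reg_norm \<epsilon> (X - P) ^ 7 - 1 / R ^ 7)) \<partial>lborel)"
  proof (intro Bochner_Integration.integral_cong refl)
    fix X
    have "1 / y X ^ 7 - 1 = R ^ 7 * (1 / reg_norm \<epsilon> (X - P) ^ 7 - 1 / R ^ 7)"
      using R by (simp add: y_def power_divide right_diff_distrib)
    moreover have "max 0 (R ^ 7 * r) = R ^ 7 * max 0 r" for r :: real
      using R by (auto simp: max_def zero_le_mult_iff)
    ultimately show "U X * max 0 (1 / y X ^ 7 - 1) = R ^ 7 * (U X * max 0 (1 / reg_norm \<epsilon> (X - P) ^ 7 - 1 / R ^ 7))"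
      by simp
  qed
  finally have 4: "(\<integral>X. U X * far_kernel e (y X) \<partial>lborel)
      - 15 * e ^ 4 * R ^ 7 * (\<integral>X. U X * max 0 (1 / reg_norm \<epsilon> (X - P) ^ 7 - 1 / R ^ 7) \<partial>lborel)
      = - 2 * R ^ 4 * (\<integral>y. f y * profile 0 (q P (y, 0)) \<partial>lborel)"
    using 3 by simp
  \<comment> \<open>Identity \<open>4\<close> is to be divided by \<open>- R^3\<close>: the near
    term keeps \<open>\<epsilon>^4\<close> and no power of \<open>R\<close>, the far term gets
    \<open>1 / R^3\<close>, the boundary term a single factor \<open>R\<close>.\<close>
  have "e ^ 4 * R ^ 7 = R ^ 3 * \<epsilon> ^ 4" using R by (simp add: e_def field_simps eval_nat_numeral)
  have "- (a - 15 * (e ^ 4 * R ^ 7) * b) / R ^ 3 = 15 * \<epsilon> ^ 4 * b - a / R ^ 3" for a b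
    unfolding \<open>e ^ 4 * R ^ 7 = R ^ 3 * \<epsilon> ^ 4\<close> using R by (simp add: field_simps)
  moreover have "- (- 2 * R ^ 4 * c) / R ^ 3 = 2 * (R * c)" for c
    using R by (simp add: field_simps eval_nat_numeral)
  moreover have "(\<integral>w. f w * (R * profile 0 ((y (w, 0))\<^sup>2)) \<partial>lborel) = R * (\<integral>w. f w * profile 0 (q P (w, 0)) \<partial>lborel)"
    unfolding y(2) by (subst integral_mult_right_zero[symmetric]) (simp add: mult_ac)
  ultimately show ?thesis
    using 4 unfolding y_def e_def by (metis (no_types, lifting) mult.assoc)
qed

section \<open>Limits of the regularized terms\<close>

text \<open>Regularizing amounts to adding a coordinate of fixed value \<open>\<epsilon>\<close>;
  the triangle inequality in the larger space gives the next two estimates.\<close>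

lemma reg_norm_eq_norm_Pair: "reg_norm \<epsilon> z = norm (z, \<epsilon>)"
  by (simp add: reg_norm_def norm_Pair)

lemma reg_norm_diff_le: "\<bar>reg_norm \<epsilon> x - reg_norm \<epsilon> y\<bar> \<le> norm (x - y)"
  using norm_triangle_ineq3[of "(x, \<epsilon>)" "(y, \<epsilon>)"] by (simp add: reg_norm_eq_norm_Pair)

lemma reg_norm_le: "\<epsilon> \<ge> 0 \<Longrightarrow> reg_norm \<epsilon> z \<le> norm z + \<epsilon>"
  using norm_triangle_ineq[of "(z, 0)" "(0, \<epsilon>)"] by (simp add: reg_norm_eq_norm_Pair)

lemma reg_norm_mono: "0 \<le> \<epsilon> \<Longrightarrow> \<epsilon> \<le> \<delta> \<Longrightarrow> reg_norm \<epsilon> z \<le> reg_norm \<delta> z"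
  unfolding reg_norm_def by (intro real_sqrt_le_mono add_left_mono power_mono)

lemma reg_norm_scale: "\<epsilon> \<ge> 0 \<Longrightarrow> reg_norm \<epsilon> (\<epsilon> *\<^sub>R z) = \<epsilon> * reg_norm 1 z"
  by (simp add: reg_norm_def power_mult_distrib real_sqrt_mult flip: distrib_left[of "\<epsilon>\<^sup>2" _ 1, simplified])

lemma borel_measurable_reg_norm [measurable]:
  "(\<lambda>z. reg_norm \<epsilon> (z::'a::euclidean_space)) \<in> borel_measurable borel"
  by (intro borel_measurable_continuous_onI continuous_intros)

text \<open>Both \<open>norm z\<close> and \<open>\<epsilon>\<close> lie below the regularized norm,
  so \<open>1 + \<epsilon>\<close> times it is at least
  \<open>\<epsilon> + \<epsilon> * norm z\<close>. It turns kernel bounds into powers of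
  \<open>1 + norm z\<close>.\<close>

lemma reg_norm_lower:
  assumes "\<epsilon> > 0"
  shows "\<epsilon> / (1 + \<epsilon>) * (1 + norm z) \<le> reg_norm \<epsilon> z"
proof -
  have "\<epsilon> * norm z \<le> \<epsilon> * reg_norm \<epsilon> z"
    using assms by (intro mult_left_mono reg_norm_ge) simp
  moreover have "\<epsilon> * (1 + norm z) = \<epsilon> + \<epsilon> * norm z" "reg_norm \<epsilon> z * (1 + \<epsilon>) = reg_norm \<epsilon> z + \<epsilon> * reg_norm \<epsilon> z"
    by (simp_all add: algebra_simps)
  ultimately have "\<epsilon> * (1 + norm z) \<le> reg_norm \<epsilon> z * (1 + \<epsilon>)"
    using reg_norm_ge(2)[of \<epsilon> z] assms by linarith
  then show ?thesis using assms by (simp add: field_simps)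
qed

section \<open>The near kernel: scaling, integrability, concentration at the centre\<close>

lemma integral_lborel_affine:
  fixes h :: "'a::euclidean_space \<Rightarrow> real"
  assumes [measurable]: "h \<in> borel_measurable borel" and "s \<noteq> 0"
  shows "(\<integral>X. h X \<partial>lborel) = \<bar>s\<bar> ^ DIM('a) * (\<integral>X. h (P + s *\<^sub>R X) \<partial>lborel)"
proof -
  have "(\<integral>X. h X \<partial>lborel) = (\<integral>X. h X \<partial>(density (distr lborel borel (\<lambda>X. P + s *\<^sub>R X)) (\<lambda>_. ennreal (\<bar>s\<bar> ^ DIM('a)))))"
    using lborel_affine[OF \<open>s \<noteq> 0\<close>, of P] by simp
  also have "\<dots> = (\<integral>X. \<bar>s\<bar> ^ DIM('a) * h X \<partial>(distr lborel borel (\<lambda>X. P + s *\<^sub>R X)))"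
    by (subst integral_density) auto
  also have "\<dots> = (\<integral>X. \<bar>s\<bar> ^ DIM('a) * h (P + s *\<^sub>R X) \<partial>lborel)"
    by (subst integral_distr) auto
  finally show ?thesis by simp
qed

lemma add_norm_bound:
  "s \<ge> 0 \<Longrightarrow> s \<le> 1 \<Longrightarrow> 1 + norm (P + s *\<^sub>R X) \<le> (1 + norm P) * (1 + norm (X :: 'a::real_normed_vector))"
proof -
  assume s: "s \<ge> 0" "s \<le> 1"
  have "norm (P + s *\<^sub>R X) \<le> norm P + s * norm X"
    using norm_triangle_ineq[of P "s *\<^sub>R X"] s by simp
  also have "s * norm X \<le> 1 * norm X" using s by (intro mult_right_mono) auto
  finally have "norm (P + s *\<^sub>R X) \<le> norm P + norm X" by simp
  also have "norm P + norm X \<le> (1 + norm P) * (1 + norm X) - 1"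
    by (simp add: algebra_simps)
  finally show ?thesis by simp
qed

text \<open>Linear growth against the seventh power leaves decay of order 6, more than the dimension
  3. Uniformity in \<open>s\<close> lets the bound serve integrability (\<open>s = 1\<close>) and
  domination in the concentration limit.\<close>

lemma near_kernel_bound:
  fixes U :: "R3 \<Rightarrow> real"
  assumes bound: "\<And>X. \<bar>U X\<bar> \<le> A * (1 + norm X)" and "\<epsilon> > 0" "0 \<le> s" "s \<le> 1"
  shows "\<bar>U (P + s *\<^sub>R X) / reg_norm \<epsilon> X ^ 7\<bar> \<le> A * (1 + norm P) / (\<epsilon> / (1 + \<epsilon>)) ^ 7 * (1 / (1 + norm X) ^ 6)"
proof -
  have A: "A \<ge> 0" using bound[of 0] by simp
  let ?m = "\<epsilon> / (1 + \<epsilon>)"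
  have m: "?m > 0" using assms by simp
  have n: "1 + norm X > 0" using norm_ge_zero[of X] by linarith
  have "\<bar>U (P + s *\<^sub>R X)\<bar> \<le> A * ((1 + norm P) * (1 + norm X))"
    using bound[of "P + s *\<^sub>R X"] mult_left_mono[OF add_norm_bound[OF assms(3,4), of P X] A] by linarith
  moreover have "(?m * (1 + norm X)) ^ 7 \<le> reg_norm \<epsilon> X ^ 7"
    by (intro power_mono reg_norm_lower assms mult_nonneg_nonneg less_imp_le[OF m] less_imp_le[OF n])
  ultimately have "\<bar>U (P + s *\<^sub>R X)\<bar> / reg_norm \<epsilon> X ^ 7 \<le> A * ((1 + norm P) * (1 + norm X)) / (?m * (1 + norm X)) ^ 7"
    using m n A by (intro frac_le zero_less_power mult_pos_pos mult_nonneg_nonneg) auto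
  also have "\<dots> = A * (1 + norm P) / ?m ^ 7 * ((1 + norm X) / (1 + norm X) ^ 7)"
    by (simp only: power_mult_distrib times_divide_times_eq mult.assoc)
  also have "(1 + norm X) / (1 + norm X) ^ 7 = 1 / (1 + norm X) ^ 6"
    using n by (simp add: eval_nat_numeral)
  finally show ?thesis
    using reg_norm_pos[OF assms(2), of X] by simp
qed

lemma integrable_near_kernel:
  fixes U :: "R3 \<Rightarrow> real"
  assumes cont: "continuous_on UNIV U" and bound: "\<And>X. \<bar>U X\<bar> \<le> A * (1 + norm X)" and "\<epsilon> > 0"
  shows "integrable lborel (\<lambda>X. U X / reg_norm \<epsilon> (X - P) ^ 7)"
proof -
  note [measurable] = borel_measurable_continuous_UNIV[OF cont]
  have "integrable lborel (\<lambda>X. U (X + P) / reg_norm \<epsilon> X ^ 7)"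
  proof (rule Bochner_Integration.integrable_bound)
    show "integrable lborel (\<lambda>X::R3. A * (1 + norm P) / (\<epsilon> / (1 + \<epsilon>)) ^ 7 * (1 / (1 + norm X) ^ 6))"
      by (intro integrable_mult_right integrable_one_plus_norm_power) simp
    show "AE X in lborel. norm (U (X + P) / reg_norm \<epsilon> X ^ 7)
        \<le> norm (A * (1 + norm P) / (\<epsilon> / (1 + \<epsilon>)) ^ 7 * (1 / (1 + norm X) ^ 6))"
    proof (rule AE_I2)
      fix X
      show "norm (U (X + P) / reg_norm \<epsilon> X ^ 7)
        \<le> norm (A * (1 + norm P) / (\<epsilon> / (1 + \<epsilon>)) ^ 7 * (1 / (1 + norm X) ^ 6))"
        using near_kernel_bound[of U A \<epsilon> 1 P X] bound \<open>\<epsilon> > 0\<close> unfolding real_norm_def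
        by (intro order_trans[OF _ abs_ge_self]) (simp add: add.commute)
    qed
  qed auto
  from integrable_lborel_translate[OF this, of "- P"] show ?thesis by simp
qed

text \<open>The truncated kernel lies between 0 and the full kernel, which supplies the dominating
  function.\<close>

lemma near_kernel_limit:
  fixes U :: "R3 \<Rightarrow> real"
  assumes cont: "continuous_on UNIV U" and bound: "\<And>X. \<bar>U X\<bar> \<le> A * (1 + norm X)" and \<epsilon>: "\<epsilon> > 0"
  shows "(\<lambda>n. \<integral>X. U X * max 0 (1 / reg_norm \<epsilon> (X - P) ^ 7 - 1 / real n ^ 7) \<partial>lborel)
    \<longlonglongrightarrow> (\<integral>X. U X / reg_norm \<epsilon> (X - P) ^ 7 \<partial>lborel)"
proof (rule integral_dominated_convergence)
  note [measurable] = borel_measurable_continuous_UNIV[OF cont]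
  show "integrable lborel (\<lambda>X. norm (U X / reg_norm \<epsilon> (X - P) ^ 7))"
    by (intro integrable_norm integrable_near_kernel[OF assms])
  show "AE X in lborel. (\<lambda>n. U X * max 0 (1 / reg_norm \<epsilon> (X - P) ^ 7 - 1 / real n ^ 7))
      \<longlonglongrightarrow> U X / reg_norm \<epsilon> (X - P) ^ 7"
  proof (rule AE_I2)
    fix X
    have "(\<lambda>n. 1 / real n ^ 7) \<longlonglongrightarrow> 0" by real_asymp
    then have "(\<lambda>n. U X * max 0 (1 / reg_norm \<epsilon> (X - P) ^ 7 - 1 / real n ^ 7))
      \<longlonglongrightarrow> U X * max 0 (1 / reg_norm \<epsilon> (X - P) ^ 7 - 0)"
      by (intro tendsto_intros)
    then show "(\<lambda>n. U X * max 0 (1 / reg_norm \<epsilon> (X - P) ^ 7 - 1 / real n ^ 7))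
      \<longlonglongrightarrow> U X / reg_norm \<epsilon> (X - P) ^ 7"
      using reg_norm_pos[OF \<epsilon>, of "X - P"] by (simp add: max_absorb2)
  qed
  show "AE X in lborel. norm (U X * max 0 (1 / reg_norm \<epsilon> (X - P) ^ 7 - 1 / real n ^ 7))
      \<le> norm (U X / reg_norm \<epsilon> (X - P) ^ 7)" for n
  proof (rule AE_I2)
    fix X
    have "\<bar>max 0 (1 / reg_norm \<epsilon> (X - P) ^ 7 - 1 / real n ^ 7)\<bar> \<le> 1 / reg_norm \<epsilon> (X - P) ^ 7"
      using reg_norm_pos[OF \<epsilon>, of "X - P"] by (auto simp: max_def)
    from mult_left_mono[OF this abs_ge_zero[of "U X"]]
    show "norm (U X * max 0 (1 / reg_norm \<epsilon> (X - P) ^ 7 - 1 / real n ^ 7))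
      \<le> norm (U X / reg_norm \<epsilon> (X - P) ^ 7)"
      using reg_norm_pos[OF \<epsilon>, of "X - P"] by (simp add: abs_mult)
  qed
qed (use borel_measurable_continuous_UNIV[OF cont] in measurable)

lemma approximate_identity:
  fixes U :: "R3 \<Rightarrow> real"
  assumes cont: "continuous_on UNIV U" and bound: "\<And>X. \<bar>U X\<bar> \<le> A * (1 + norm X)"
  defines "\<delta> \<equiv> \<lambda>n. inverse (real (Suc n))"
  shows "(\<lambda>n. 15 * \<delta> n ^ 4 * (\<integral>X. U X / reg_norm (\<delta> n) (X - P) ^ 7 \<partial>lborel)) \<longlonglongrightarrow> 8 * pi * U P"
proof -
  note [measurable] = borel_measurable_continuous_UNIV[OF cont]
  have \<delta>: "\<delta> n > 0" "\<delta> n \<le> 1" for n by (auto simp: \<delta>_def field_simps)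
  \<comment> \<open>Rescaling about \<open>P\<close>: the prefactor \<open>\<delta>^4\<close> and
    the Jacobian \<open>\<delta>^3\<close> cancel the \<open>\<delta>^7\<close> that the kernel
    releases by homogeneity.\<close>
  have eq: "15 * \<delta> n ^ 4 * (\<integral>X. U X / reg_norm (\<delta> n) (X - P) ^ 7 \<partial>lborel)
      = (\<integral>X. U (P + \<delta> n *\<^sub>R X) * (15 / reg_norm 1 X ^ 7) \<partial>lborel)" for n
  proof -
    have "(\<integral>X. U X / reg_norm (\<delta> n) (X - P) ^ 7 \<partial>lborel)
        = \<delta> n ^ 3 * (\<integral>X. U (P + \<delta> n *\<^sub>R X) / reg_norm (\<delta> n) (\<delta> n *\<^sub>R X) ^ 7 \<partial>lborel)"
      using \<delta>(1)[of n] by (subst integral_lborel_affine[of _ "\<delta> n" P]) auto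
    then have "15 * \<delta> n ^ 4 * (\<integral>X. U X / reg_norm (\<delta> n) (X - P) ^ 7 \<partial>lborel)
        = (\<integral>X. 15 * \<delta> n ^ 7 * (U (P + \<delta> n *\<^sub>R X) / reg_norm (\<delta> n) (\<delta> n *\<^sub>R X) ^ 7) \<partial>lborel)"
      by (subst integral_mult_right_zero) (simp add: eval_nat_numeral)
    also have "\<dots> = (\<integral>X. U (P + \<delta> n *\<^sub>R X) * (15 / reg_norm 1 X ^ 7) \<partial>lborel)"
      using \<delta>(1)[of n] by (intro Bochner_Integration.integral_cong refl) (simp add: reg_norm_scale power_mult_distrib)
    finally show ?thesis .
  qed
  have "(\<lambda>n. \<integral>X. U (P + \<delta> n *\<^sub>R X) * (15 / reg_norm 1 X ^ 7) \<partial>lborel)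
      \<longlonglongrightarrow> (\<integral>(X::R3). U P * (15 / reg_norm 1 X ^ 7) \<partial>lborel)"
  proof (rule integral_dominated_convergence)
    show "integrable lborel (\<lambda>X::R3. 15 * (A * (1 + norm P) / (1 / (1 + 1)) ^ 7 * (1 / (1 + norm X) ^ 6)))"
      by (intro integrable_mult_right integrable_one_plus_norm_power) simp
    show "AE X in lborel. (\<lambda>n. U (P + \<delta> n *\<^sub>R X) * (15 / reg_norm 1 X ^ 7)) \<longlonglongrightarrow> U P * (15 / reg_norm 1 X ^ 7)"
    proof (rule AE_I2)
      fix X :: R3
      have "\<delta> \<longlonglongrightarrow> 0" unfolding \<delta>_def by (rule LIMSEQ_inverse_real_of_nat)
      then have "(\<lambda>n. P + \<delta> n *\<^sub>R X) \<longlonglongrightarrow> P + 0 *\<^sub>R X" by (intro tendsto_intros)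
      then have "(\<lambda>n. P + \<delta> n *\<^sub>R X) \<longlonglongrightarrow> P" by simp
      moreover have "isCont U P"
        using cont by (metis UNIV_I continuous_on_eq_continuous_at open_UNIV)
      ultimately have "(\<lambda>n. U (P + \<delta> n *\<^sub>R X)) \<longlonglongrightarrow> U P" by (rule isCont_tendsto_compose[rotated])
      then show "(\<lambda>n. U (P + \<delta> n *\<^sub>R X) * (15 / reg_norm 1 X ^ 7)) \<longlonglongrightarrow> U P * (15 / reg_norm 1 X ^ 7)"
        by (intro tendsto_intros)
    qed
    show "AE X in lborel. norm (U (P + \<delta> n *\<^sub>R X) * (15 / reg_norm 1 X ^ 7))
        \<le> 15 * (A * (1 + norm P) / (1 / (1 + 1)) ^ 7 * (1 / (1 + norm X) ^ 6))" for n
    proof (rule AE_I2)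
      fix X
      have "norm (U (P + \<delta> n *\<^sub>R X) * (15 / reg_norm 1 X ^ 7)) = 15 * \<bar>U (P + \<delta> n *\<^sub>R X) / reg_norm 1 X ^ 7\<bar>"
        by (simp add: abs_mult)
      also have "\<dots> \<le> 15 * (A * (1 + norm P) / (1 / (1 + 1)) ^ 7 * (1 / (1 + norm X) ^ 6))"
        using \<delta>[of n] by (intro mult_left_mono near_kernel_bound bound) auto
      finally show "norm (U (P + \<delta> n *\<^sub>R X) * (15 / reg_norm 1 X ^ 7))
        \<le> 15 * (A * (1 + norm P) / (1 / (1 + 1)) ^ 7 * (1 / (1 + norm X) ^ 6))" .
    qed
  qed auto
  also have "(\<integral>X. U P * (15 / reg_norm 1 X ^ 7) \<partial>(lborel :: R3 measure)) = 8 * pi * U P"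
    unfolding integral_mult_right_zero using integral_bubble by (simp add: reg_norm_def)
  finally show ?thesis by (simp add: eq)
qed

section \<open>The boundary integral: removing the cut-off and the regularization\<close>

lemma profile_0_eq:
  assumes "0 < x" "x < 1"
  shows "profile 0 x = sqrt x * (1 - x ^ 4) ^ 5"
proof -
  have pw: "x powr (4 * real j + 1 / 2) = sqrt x * (x ^ 4) ^ j" for j
  proof -
    have "x powr (4 * real j + 1 / 2) = x powr real (4 * j) * x powr (1 / 2)"
      by (simp flip: powr_add)
    also have "x powr real (4 * j) = (x ^ 4) ^ j"
      using powr_realpow[OF assms(1), of "4 * j"] by (simp only: power_mult)
    also have "x powr (1 / 2) = sqrt x" using assms(1) by (simp add: powr_half_sqrt)
    finally show ?thesis by simp
  qed
  have "(1 - x ^ 4) ^ 5 = (- (x ^ 4) + 1) ^ 5" by simp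
  also have "\<dots> = (\<Sum>j\<le>5. real (5 choose j) * (- (x ^ 4)) ^ j * 1 ^ (5 - j))"
    by (rule binomial_ring)
  finally have "sqrt x * (1 - x ^ 4) ^ 5 = (\<Sum>j\<le>5. sqrt x * (real (5 choose j) * (- (x ^ 4)) ^ j))"
    by (simp add: sum_distrib_left)
  also have "\<dots> = profile_poly 0 x"
    unfolding profile_poly_def
    by (intro sum.cong refl) (simp add: profile_coeff_def falling_def pw power_minus[of "x ^ 4"])
  finally show ?thesis using assms by (simp add: profile_def)
qed

lemma scaled_profile_0:
  assumes r: "r > 0" and "R > 0"
  shows "R * profile 0 ((r / R)\<^sup>2) = (if r < R then r * (1 - (r / R) ^ 8) ^ 5 else 0)"
proof -
  have "(r / R)\<^sup>2 < 1 \<longleftrightarrow> r < R"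
    using assms by (simp add: power_less_one_iff)
  moreover have "R * (sqrt ((r / R)\<^sup>2) * (1 - ((r / R)\<^sup>2) ^ 4) ^ 5) = r * (1 - (r / R) ^ 8) ^ 5"
    using assms by (simp flip: power_mult)
  ultimately show ?thesis
    using assms profile_0_eq[of "(r / R)\<^sup>2"] by (auto simp: profile_def)
qed

lemma boundary_limit:
  fixes f :: "real^2 \<Rightarrow> real" and P :: R3
  assumes int: "integrable lborel (\<lambda>y. f y * reg_norm \<epsilon> ((y, 0) - P))" and f[measurable]: "f \<in> borel_measurable borel" and \<epsilon>: "\<epsilon> > 0"
  shows "(\<lambda>n. \<integral>y. f y * (real n * profile 0 ((reg_norm \<epsilon> ((y, 0) - P) / real n)\<^sup>2)) \<partial>lborel)
    \<longlonglongrightarrow> (\<integral>y. f y * reg_norm \<epsilon> ((y, 0) - P) \<partial>lborel)"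
proof (rule integral_dominated_convergence)
  let ?r = "\<lambda>y. reg_norm \<epsilon> ((y, 0) - P)"
  have r: "?r y > 0" for y by (rule reg_norm_pos[OF \<epsilon>])
  have rm: "?r \<in> borel_measurable borel"
    by (intro borel_measurable_continuous_onI continuous_intros)
  \<comment> \<open>For n = 0 both sides are 0: the left by its factor \<open>real n\<close>, the
    right because the regularized norm is positive.\<close>
  have eq: "real n * profile 0 ((?r y / real n)\<^sup>2) = (if ?r y < real n then ?r y * (1 - (?r y / real n) ^ 8) ^ 5 else 0)" for n y
    using scaled_profile_0[OF r, of "real n" y] r[of y] by (cases "n = 0") auto
  show "integrable lborel (\<lambda>y. norm (f y * ?r y))" using int by (rule integrable_norm)
  show "AE y in lborel. (\<lambda>n. f y * (real n * profile 0 ((?r y / real n)\<^sup>2))) \<longlonglongrightarrow> f y * ?r y"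
  proof (rule AE_I2)
    fix y
    have "(\<lambda>n. ?r y / real n) \<longlonglongrightarrow> 0" by (rule lim_const_over_n)
    then have "(\<lambda>n. ?r y * (1 - (?r y / real n) ^ 8) ^ 5) \<longlonglongrightarrow> ?r y * (1 - 0 ^ 8) ^ 5"
      by (intro tendsto_intros)
    then have "(\<lambda>n. ?r y * (1 - (?r y / real n) ^ 8) ^ 5) \<longlonglongrightarrow> ?r y" by simp
    moreover have "\<forall>\<^sub>F n in sequentially. ?r y * (1 - (?r y / real n) ^ 8) ^ 5 = real n * profile 0 ((?r y / real n)\<^sup>2)"
      using eventually_gt_at_top[of "nat \<lceil>?r y\<rceil>"] unfolding eq by eventually_elim (auto, linarith)
    ultimately have "(\<lambda>n. real n * profile 0 ((?r y / real n)\<^sup>2)) \<longlonglongrightarrow> ?r y"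
      by (rule Lim_transform_eventually)
    then show "(\<lambda>n. f y * (real n * profile 0 ((?r y / real n)\<^sup>2))) \<longlonglongrightarrow> f y * ?r y"
      by (intro tendsto_intros)
  qed
  show "AE y in lborel. norm (f y * (real n * profile 0 ((?r y / real n)\<^sup>2))) \<le> norm (f y * ?r y)" for n
  proof (rule AE_I2)
    fix y
    have "\<bar>real n * profile 0 ((?r y / real n)\<^sup>2)\<bar> \<le> ?r y"
    proof (cases "?r y < real n")
      case True
      then have "0 \<le> ?r y / real n" "?r y / real n \<le> 1" using r[of y] by auto
      then have "0 \<le> (?r y / real n) ^ 8" "(?r y / real n) ^ 8 \<le> 1" by (auto intro: power_le_one)
      then have "\<bar>(1 - (?r y / real n) ^ 8) ^ 5\<bar> \<le> 1" by (auto simp: power_abs intro: power_le_one)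
      from mult_left_mono[OF this, of "?r y"] show ?thesis
        unfolding eq using True r[of y] by (simp add: abs_mult)
    qed (use r[of y] in \<open>auto simp: eq\<close>)
    from mult_left_mono[OF this abs_ge_zero[of "f y"]]
    show "norm (f y * (real n * profile 0 ((?r y / real n)\<^sup>2))) \<le> norm (f y * ?r y)"
      using r[of y] by (simp add: abs_mult)
  qed
  have "(\<lambda>y. f y * (if ?r y < real n then ?r y * (1 - (?r y / real n) ^ 8) ^ 5 else 0)) \<in> borel_measurable lborel" for n
    using rm by measurable
  then show "(\<lambda>y. f y * (real n * profile 0 ((?r y / real n)\<^sup>2))) \<in> borel_measurable lborel" for n
    by (simp only: eq)
  show "(\<lambda>y. f y * ?r y) \<in> borel_measurable lborel" using rm by measurable
qed

text \<open>The threshold \<open>a > 3\<close> comes from here: one power is lost to the growth of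
  the norm, and the remaining decay \<open>a - 1\<close> has to exceed the dimension 2 of the
  boundary.\<close>

lemma integrable_decay_times_reg_norm:
  fixes f :: "real^2 \<Rightarrow> real" and P :: R3
  assumes decay: "\<And>y. \<bar>f y\<bar> \<le> K * (1 + norm y) powr (- a)" and a: "a > 3"
    and f[measurable]: "f \<in> borel_measurable borel" and \<epsilon>: "\<epsilon> \<ge> 0"
  shows "integrable lborel (\<lambda>y. f y * reg_norm \<epsilon> ((y, 0) - P))"
proof (rule Bochner_Integration.integrable_bound)
  have K: "K \<ge> 0" using decay[of 0] by simp
  show "integrable lborel (\<lambda>y::real^2. K * (1 + norm P + \<epsilon>) * (1 + norm y) powr (- (a - 1)))"
    using a by (intro integrable_mult_right integrable_one_plus_norm_powr) simp
  have "(\<lambda>y::real^2. reg_norm \<epsilon> ((y, 0) - P)) \<in> borel_measurable borel"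
    by (intro borel_measurable_continuous_onI continuous_intros)
  then show "(\<lambda>y. f y * reg_norm \<epsilon> ((y, 0) - P)) \<in> borel_measurable lborel" by measurable
  show "AE y in lborel. norm (f y * reg_norm \<epsilon> ((y, 0) - P)) \<le> norm (K * (1 + norm P + \<epsilon>) * (1 + norm y) powr (- (a - 1)))"
  proof (rule AE_I2)
    fix y :: "real^2"
    have n: "1 + norm y > 0" using norm_ge_zero[of y] by linarith
    have "reg_norm \<epsilon> ((y, 0) - P) \<le> norm y + norm P + \<epsilon>"
      using reg_norm_le[OF \<epsilon>, of "(y, 0) - P"] norm_triangle_ineq4[of "(y, 0)" P] by simp
    also have "\<dots> \<le> (1 + norm P + \<epsilon>) * (1 + norm y)"
      using \<epsilon> mult_nonneg_nonneg[OF norm_ge_zero[of P] norm_ge_zero[of y]] mult_nonneg_nonneg[OF \<epsilon> norm_ge_zero[of y]]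
      by (simp add: algebra_simps)
    finally have 1: "reg_norm \<epsilon> ((y, 0) - P) \<le> (1 + norm P + \<epsilon>) * (1 + norm y)" .
    have 0: "0 \<le> reg_norm \<epsilon> ((y, 0) - P)" by (simp add: reg_norm_def)
    have "norm (f y * reg_norm \<epsilon> ((y, 0) - P)) \<le> (K * (1 + norm y) powr (- a)) * ((1 + norm P + \<epsilon>) * (1 + norm y))"
      unfolding norm_mult using 0 1 decay[of y] K n by (intro mult_mono) auto
    also have "\<dots> = K * (1 + norm P + \<epsilon>) * ((1 + norm y) powr (- a) * (1 + norm y) powr 1)"
      using n by simp
    also have "(1 + norm y) powr (- a) * (1 + norm y) powr 1 = (1 + norm y) powr (- (a - 1))"
      by (subst powr_add[symmetric]) (simp add: algebra_simps)
    finally show "norm (f y * reg_norm \<epsilon> ((y, 0) - P)) \<le> norm (K * (1 + norm P + \<epsilon>) * (1 + norm y) powr (- (a - 1)))"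
      unfolding real_norm_def by linarith
  qed
qed

text \<open>The regularized norm increases with \<open>\<epsilon>\<close>, so the integrand at
  \<open>\<epsilon> = 1\<close> dominates.\<close>

lemma boundary_regularization_limit:
  fixes f :: "real^2 \<Rightarrow> real" and P :: R3
  assumes decay: "\<And>y. \<bar>f y\<bar> \<le> K * (1 + norm y) powr (- a)" and a: "a > 3"
    and f[measurable]: "f \<in> borel_measurable borel"
  shows "(\<lambda>n. \<integral>y. f y * reg_norm (inverse (real (Suc n))) ((y, 0) - P) \<partial>lborel) \<longlonglongrightarrow> (\<integral>y. f y * norm ((y, 0) - P) \<partial>lborel)"
proof (rule integral_dominated_convergence)
  have rm: "(\<lambda>y::real^2. reg_norm \<epsilon> ((y, 0) - P)) \<in> borel_measurable borel"
    "(\<lambda>y::real^2. norm ((y, 0) - P)) \<in> borel_measurable borel" for \<epsilon>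
    by (intro borel_measurable_continuous_onI continuous_intros)+
  show "(\<lambda>y. f y * reg_norm (inverse (real (Suc n))) ((y, 0) - P)) \<in> borel_measurable lborel"
    "(\<lambda>y. f y * norm ((y, 0) - P)) \<in> borel_measurable lborel" for n
    using rm by measurable
  show "integrable lborel (\<lambda>y. norm (f y * reg_norm 1 ((y, 0) - P)))"
    by (intro integrable_norm integrable_decay_times_reg_norm[OF decay a f]) simp
  show "AE y in lborel. (\<lambda>n. f y * reg_norm (inverse (real (Suc n))) ((y, 0) - P)) \<longlonglongrightarrow> f y * norm ((y, 0) - P)"
  proof (rule AE_I2)
    fix y
    have "(\<lambda>n. f y * sqrt ((norm ((y, 0) - P))\<^sup>2 + (inverse (real (Suc n)))\<^sup>2)) \<longlonglongrightarrow> f y * sqrt ((norm ((y, 0) - P))\<^sup>2 + 0\<^sup>2)"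
      by (intro tendsto_intros LIMSEQ_inverse_real_of_nat)
    then show "(\<lambda>n. f y * reg_norm (inverse (real (Suc n))) ((y, 0) - P)) \<longlonglongrightarrow> f y * norm ((y, 0) - P)"
      by (simp add: reg_norm_def)
  qed
  show "AE y in lborel. norm (f y * reg_norm (inverse (real (Suc n))) ((y, 0) - P)) \<le> norm (f y * reg_norm 1 ((y, 0) - P))" for n
  proof (rule AE_I2)
    fix y
    have "\<bar>reg_norm (inverse (real (Suc n))) ((y, 0) - P)\<bar> \<le> \<bar>reg_norm 1 ((y, 0) - P)\<bar>"
      using reg_norm_mono[of "inverse (real (Suc n))" 1 "(y, 0) - P"] by (simp add: reg_norm_def field_simps)
    then show "norm (f y * reg_norm (inverse (real (Suc n))) ((y, 0) - P)) \<le> norm (f y * reg_norm 1 ((y, 0) - P))"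
      unfolding real_norm_def abs_mult by (intro mult_left_mono) auto
  qed
qed

section \<open>The far kernel\<close>

lemma integral_lborel_minus:
  fixes h :: "'a::euclidean_space \<Rightarrow> real"
  assumes "h \<in> borel_measurable borel"
  shows "(\<integral>X. h (- X) \<partial>lborel) = (\<integral>X. h X \<partial>lborel)"
  using integral_lborel_affine[OF assms, of "-1" 0] by simp

lemma integral_indicator_cball:
  "r \<ge> 0 \<Longrightarrow> (\<integral>X. indicator (cball (0 :: R3) r) X \<partial>lborel) = 4 / 3 * pi * r ^ 3"
  using content_cball[of r "0 :: R3"] unit_ball_vol_3 by simp

lemma integral_cball_bound:
  fixes h :: "R3 \<Rightarrow> real"
  assumes h: "integrable lborel h" and r: "r \<ge> 0" and bound: "\<And>X. \<bar>h X\<bar> \<le> B * indicator (cball 0 r) X"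
  shows "\<bar>\<integral>X. h X \<partial>lborel\<bar> \<le> B * (4 / 3 * pi * r ^ 3)"
proof -
  have "\<bar>\<integral>X. h X \<partial>lborel\<bar> \<le> (\<integral>X. \<bar>h X\<bar> \<partial>lborel)" by (rule integral_abs_bound)
  also have "\<dots> \<le> (\<integral>X. B * indicator (cball 0 r) X \<partial>(lborel :: R3 measure))"
    using h bound by (intro integral_mono integrable_abs integrable_mult_right integrable_indicator_cball) auto
  also have "\<dots> = B * (4 / 3 * pi * r ^ 3)"
    by (subst integral_mult_right_zero) (simp only: integral_indicator_cball[OF r])
  finally show ?thesis .
qed

lemma continuous_on_far_kernel [continuous_intros]:
  "continuous_on S g \<Longrightarrow> continuous_on S (\<lambda>x. far_kernel e (g x))"
  unfolding far_kernel_def by (intro continuous_intros)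

text \<open>First differences of the norm are merely bounded; this second difference decays. By the
  parallelogram law the square of \<open>norm (X + P) + norm (X - P)\<close> is at most
  \<open>4 (norm X)^2 + 4 (norm P)^2\<close>, and completing the square gives the third
  bound.\<close>

lemma second_difference_norm:
  fixes X P :: "'a::real_inner"
  shows "0 \<le> norm (X + P) + norm (X - P) - 2 * norm X"
    and "norm (X + P) + norm (X - P) - 2 * norm X \<le> 2 * norm P"
    and "\<rho> > 0 \<Longrightarrow> norm X \<ge> \<rho> \<Longrightarrow> norm (X + P) + norm (X - P) - 2 * norm X \<le> (norm P)\<^sup>2 / \<rho>"
proof -
  have "norm ((X + P) + (X - P)) \<le> norm (X + P) + norm (X - P)" by (rule norm_triangle_ineq)
  moreover have "(X + P) + (X - P) = 2 *\<^sub>R X" by (simp add: scaleR_2)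
  ultimately show "0 \<le> norm (X + P) + norm (X - P) - 2 * norm X" by simp
  show "norm (X + P) + norm (X - P) - 2 * norm X \<le> 2 * norm P"
    using norm_triangle_ineq[of X P] norm_triangle_ineq4[of X P] by simp
  assume \<rho>: "\<rho> > 0" "norm X \<ge> \<rho>"
  then have "X \<noteq> 0" by auto
  define a where "a = norm (X + P)"
  define b where "b = norm (X - P)"
  have ab: "a\<^sup>2 + b\<^sup>2 = 2 * (norm X)\<^sup>2 + 2 * (norm P)\<^sup>2"
    unfolding a_def b_def power2_norm_eq_inner by (simp add: algebra_simps inner_commute)
  have "(a + b)\<^sup>2 \<le> 2 * (a\<^sup>2 + b\<^sup>2)"
    using zero_le_power2[of "a - b"] by (simp add: power2_eq_square algebra_simps)
  also have "\<dots> \<le> (2 * norm X + (norm P)\<^sup>2 / norm X)\<^sup>2"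
    using \<open>X \<noteq> 0\<close> by (simp add: ab power2_sum power_mult_distrib)
  finally have "a + b \<le> 2 * norm X + (norm P)\<^sup>2 / norm X"
    using \<rho> by (rule_tac power2_le_imp_le) auto
  also have "(norm P)\<^sup>2 / norm X \<le> (norm P)\<^sup>2 / \<rho>"
    using \<rho> \<open>X \<noteq> 0\<close> by (intro divide_left_mono mult_pos_pos) auto
  finally show "norm (X + P) + norm (X - P) - 2 * norm X \<le> (norm P)\<^sup>2 / \<rho>"
    by (simp add: a_def b_def)
qed

text \<open>Up to an error of size \<open>o(R)\<close>, which is multiplied by the Lipschitz bound of the kernel, \<open>U\<close>
  is \<open>c * norm X\<close>; that part contributes only the second difference of the norm since the kernel is even.\<close>
lemma far_kernel_difference_bound:
  fixes U :: "R3 \<Rightarrow> real" and P :: R3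
  assumes cont: "continuous_on UNIV U" and growth: "\<And>X. \<bar>U X - c * norm X\<bar> \<le> \<delta> * norm X + M"
    and \<delta>: "\<delta> \<ge> 0" and M: "M \<ge> 0" and \<epsilon>: "\<epsilon> > 0" and R: "R \<ge> \<epsilon>" "R \<ge> norm P" "R \<ge> 1"
    and L: "L \<ge> 0" "\<And>e y y'. \<lbrakk>0 \<le> e; e \<le> 1; y \<ge> 0; y' \<ge> 0\<rbrakk> \<Longrightarrow>
      \<bar>far_kernel e y - far_kernel e y'\<bar> \<le> L * \<bar>y - y'\<bar>"
  defines "k \<equiv> \<lambda>Q X. far_kernel (\<epsilon> / R) (reg_norm \<epsilon> (X - Q) / R)"
  shows "\<bar>((\<integral>X. U X * k P X \<partial>lborel) - (\<integral>X. U X * k 0 X \<partial>lborel)) / R ^ 3\<bar>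
    \<le> (32 / 3 * pi * L * norm P) * (2 * \<delta> + M / R)
      + \<bar>c\<bar> / 2 * (2 * norm P * L * (4 / 3 * pi) / sqrt R ^ 3 + (norm P)\<^sup>2 * L * (4 / 3 * pi) / sqrt R)"
proof -
  have R0: "R > 0" using \<epsilon> R by linarith
  have e: "0 \<le> \<epsilon> / R" "\<epsilon> / R \<le> 1" using \<epsilon> R(1) R0 by auto
  have k_cont: "continuous_on UNIV (k Q)" for Q
    unfolding k_def using R0 by (intro continuous_intros) auto
  have k_zero: "k Q X = 0" if "norm (X - Q) \<ge> R" for Q X
  proof -
    have "R \<le> reg_norm \<epsilon> (X - Q)" using that reg_norm_ge(1)[of "X - Q" \<epsilon>] by linarith
    then show ?thesis unfolding k_def using R0 by (intro far_kernel_eq_0) simp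
  qed
  have k_zero': "k Q X = 0" if "norm X > norm Q + R" for Q X
    using that norm_triangle_ineq2[of X Q] by (intro k_zero) linarith
  \<comment> \<open>Lipschitz comparison with y = 1, where the kernel vanishes, bounds it
    independently of \<open>R\<close>.\<close>
  have k_bound: "\<bar>k 0 X\<bar> \<le> L" for X
  proof (cases "norm X \<ge> R \<or> reg_norm \<epsilon> X \<ge> R")
    case True
    then have "reg_norm \<epsilon> X \<ge> R" using reg_norm_ge(1)[of X \<epsilon>] by linarith
    then have "k 0 X = 0" unfolding k_def using R0 by (intro far_kernel_eq_0) simp
    then show ?thesis using L by simp
  next
    case False
    define y where "y = reg_norm \<epsilon> X / R"
    have y: "0 \<le> y" "y \<le> 1" using False R0 reg_norm_pos[OF \<epsilon>, of X] by (auto simp: y_def)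
    have "\<bar>k 0 X\<bar> \<le> L * \<bar>y - 1\<bar>"
      using L(2)[OF e y(1), of 1] by (simp add: k_def y_def far_kernel_eq_0)
    also have "\<dots> \<le> L * 1" using y L by (intro mult_left_mono) auto
    finally show ?thesis by simp
  qed
  have k_lip: "\<bar>k P X - k 0 X\<bar> \<le> L * norm P / R" for X
  proof -
    have "\<bar>k P X - k 0 X\<bar> \<le> L * \<bar>reg_norm \<epsilon> (X - P) / R - reg_norm \<epsilon> (X - 0) / R\<bar>"
      unfolding k_def by (intro L(2) e divide_nonneg_nonneg less_imp_le[OF R0] less_imp_le[OF reg_norm_pos[OF \<epsilon>]])
    also have "\<bar>reg_norm \<epsilon> (X - P) / R - reg_norm \<epsilon> (X - 0) / R\<bar> \<le> norm P / R"
      using reg_norm_diff_le[of \<epsilon> "X - P" "X - 0"] R0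
      by (simp add: diff_divide_distrib[symmetric] divide_right_mono)
    finally show ?thesis using L(1) by (simp add: mult_left_mono)
  qed
  have int: "integrable lborel (\<lambda>X. w X * k Q X)" if "continuous_on UNIV w" for w :: "R3 \<Rightarrow> real" and Q
    using k_zero' by (intro integrable_compact_support[where M = "norm Q + R"] continuous_on_mult that k_cont) auto
  define W where "W X = U X - c * norm X" for X
  have cW: "continuous_on UNIV W" unfolding W_def by (intro continuous_intros cont)
  have cN: "continuous_on UNIV (\<lambda>X::R3. norm X)" by (intro continuous_intros)
  have "(\<integral>X. U X * k Q X \<partial>lborel) = (\<integral>X. W X * k Q X \<partial>lborel) + c * (\<integral>X. norm X * k Q X \<partial>lborel)" for Q
  proof -
    have "(\<integral>X. U X * k Q X \<partial>lborel) = (\<integral>X. W X * k Q X + c * (norm X * k Q X) \<partial>lborel)"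
      by (simp add: W_def algebra_simps)
    then show ?thesis using int[OF cW, of Q] int[OF cN, of Q] by simp
  qed
  then have split: "(\<integral>X. U X * k P X \<partial>lborel) - (\<integral>X. U X * k 0 X \<partial>lborel)
      = (\<integral>X. W X * (k P X - k 0 X) \<partial>lborel) + c * ((\<integral>X. norm X * k P X \<partial>lborel) - (\<integral>X. norm X * k 0 X \<partial>lborel))"
    using int[OF cW, of P] int[OF cW, of 0] by (simp add: right_diff_distrib)
  \<comment> \<open>The factors are a bound for \<open>W\<close>, a kernel difference of order
    \<open>1 / R\<close> and a volume of order \<open>R^3\<close>. Both kernels vanish outside the
    ball of radius \<open>2 * R\<close> because \<open>norm P \<le> R\<close>.\<close>
  have W: "\<bar>\<integral>X. W X * (k P X - k 0 X) \<partial>lborel\<bar> \<le> (\<delta> * (2 * R) + M) * (L * norm P / R) * (4 / 3 * pi * (2 * R) ^ 3)"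
  proof (rule integral_cball_bound)
    show "integrable lborel (\<lambda>X. W X * (k P X - k 0 X))"
      using int[OF cW, of P] int[OF cW, of 0] by (simp add: right_diff_distrib)
    show "0 \<le> 2 * R" using R0 by simp
    show "\<bar>W X * (k P X - k 0 X)\<bar> \<le> (\<delta> * (2 * R) + M) * (L * norm P / R) * indicator (cball 0 (2 * R)) X" for X
    proof (cases "norm X \<le> 2 * R")
      case True
      have "\<bar>W X\<bar> \<le> \<delta> * norm X + M" using growth by (simp add: W_def)
      also have "\<dots> \<le> \<delta> * (2 * R) + M" using True \<delta> by (simp add: mult_left_mono)
      finally have "\<bar>W X * (k P X - k 0 X)\<bar> \<le> (\<delta> * (2 * R) + M) * (L * norm P / R)"
        unfolding abs_mult by (intro mult_mono k_lip) auto
      then show ?thesis using True by (simp add: indicator_def)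
    next
      case False
      then show ?thesis using R(2) R0 by (simp add: k_zero')
    qed
  qed
  define b where "b X = norm (X + P) + norm (X - P) - 2 * norm X" for X
  have cb: "continuous_on UNIV b" unfolding b_def by (intro continuous_intros)
  have k_even: "k 0 (- X) = k 0 X" for X by (simp add: k_def reg_norm_def)
  \<comment> \<open>Translation moves the centre into the norm, and evenness of \<open>k 0\<close>
    makes the shifts by \<open>P\<close> and \<open>- P\<close> equivalent; averaging them yields
    half of the second difference \<open>b\<close>.\<close>
  have shift: "(\<integral>X. norm X * k P X \<partial>lborel) = (\<integral>X. norm (X + P) * k 0 X \<partial>lborel)"
  proof -
    have "(\<lambda>X. norm X * k P X) \<in> borel_measurable borel"
      by (intro borel_measurable_continuous_UNIV continuous_intros k_cont)
    from integral_lborel_translate[OF this, of P] show ?thesis by (simp add: k_def)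
  qed
  have flip: "(\<integral>X. norm (X + P) * k 0 X \<partial>lborel) = (\<integral>X. norm (X - P) * k 0 X \<partial>lborel)"
  proof -
    have "(\<lambda>X. norm (X - P) * k 0 X) \<in> borel_measurable borel"
      by (intro borel_measurable_continuous_UNIV continuous_intros k_cont)
    moreover have "norm (- X - P) = norm (X + P)" for X
      by (metis minus_add_distrib norm_minus_cancel uminus_add_conv_diff add.commute diff_conv_add_uminus)
    ultimately show ?thesis
      using integral_lborel_minus[of "\<lambda>X. norm (X - P) * k 0 X"] by (simp add: k_even)
  qed
  have c1: "continuous_on UNIV (\<lambda>X. norm (X + P))" "continuous_on UNIV (\<lambda>X. norm (X - P))"
    by (intro continuous_intros)+
  have "(\<integral>X. b X * k 0 X \<partial>lborel)
      = (\<integral>X. (norm (X + P) * k 0 X + norm (X - P) * k 0 X) - 2 * (norm X * k 0 X) \<partial>lborel)"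
    by (simp add: b_def algebra_simps)
  also have "\<dots> = 2 * ((\<integral>X. norm X * k P X \<partial>lborel) - (\<integral>X. norm X * k 0 X \<partial>lborel))"
    using int[OF c1(1), of 0] int[OF c1(2), of 0] int[OF cN, of 0] by (simp add: shift flip)
  finally have N: "(\<integral>X. norm X * k P X \<partial>lborel) - (\<integral>X. norm X * k 0 X \<partial>lborel) = (\<integral>X. b X * k 0 X \<partial>lborel) / 2"
    by simp
  \<comment> \<open>Splitting radius: inside, the bound \<open>2 * norm P\<close> meets a volume of
    order \<open>R powr (3/2)\<close>; outside, the bound \<open>(norm P)^2 / sqrt R\<close> meets a
    volume of order \<open>R^3\<close>. Both products are \<open>o(R^3)\<close>.\<close>
  define \<rho> where "\<rho> = sqrt R"
  have \<rho>: "\<rho> > 0" "\<rho> ^ 2 = R" using R0 by (auto simp: \<rho>_def)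
  have B: "\<bar>\<integral>X. b X * k 0 X \<partial>lborel\<bar> \<le> 2 * norm P * L * (4 / 3 * pi * \<rho> ^ 3) + (norm P)\<^sup>2 / \<rho> * L * (4 / 3 * pi * R ^ 3)"
  proof -
    have cb_bound: "\<bar>b X * k 0 X\<bar> \<le> 2 * norm P * L * indicator (cball 0 \<rho>) X + (norm P)\<^sup>2 / \<rho> * L * indicator (cball 0 R) X" for X
    proof (cases "norm X \<le> \<rho>")
      case True
      have "\<bar>b X\<bar> \<le> 2 * norm P" using second_difference_norm(1,2)[of X P] by (simp add: b_def)
      then have "\<bar>b X * k 0 X\<bar> \<le> 2 * norm P * L"
        unfolding abs_mult using k_bound by (intro mult_mono) auto
      moreover have "0 \<le> (norm P)\<^sup>2 / \<rho> * L * indicator (cball 0 R) X" using \<rho> L(1) by simp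
      ultimately show ?thesis using True by (simp add: indicator_def)
    next
      case False
      show ?thesis
      proof (cases "norm X \<le> R")
        case True
        have "\<bar>b X\<bar> \<le> (norm P)\<^sup>2 / \<rho>"
          using second_difference_norm(1)[of X P] second_difference_norm(3)[OF \<rho>(1), of X P] False by (simp add: b_def)
        then have "\<bar>b X * k 0 X\<bar> \<le> (norm P)\<^sup>2 / \<rho> * L"
          unfolding abs_mult using k_bound \<rho>(1) by (intro mult_mono) auto
        then show ?thesis using True False by (simp add: indicator_def)
      next
        case F: False
        then have "k 0 X = 0" by (intro k_zero) simp
        then show ?thesis using F False by simp
      qed
    qed
    have ib: "integrable lborel (\<lambda>X. b X * k 0 X)" by (rule int[OF cb])
    have "\<bar>\<integral>X. b X * k 0 X \<partial>lborel\<bar> \<le> (\<integral>X. \<bar>b X * k 0 X\<bar> \<partial>lborel)" by (rule integral_abs_bound)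
    also have "\<dots> \<le> (\<integral>X. 2 * norm P * L * indicator (cball 0 \<rho>) X + (norm P)\<^sup>2 / \<rho> * L * indicator (cball 0 R) X \<partial>(lborel :: R3 measure))"
      using ib cb_bound by (intro integral_mono integrable_abs Bochner_Integration.integrable_add integrable_mult_right integrable_indicator_cball)
    also have "\<dots> = 2 * norm P * L * (4 / 3 * pi * \<rho> ^ 3) + (norm P)\<^sup>2 / \<rho> * L * (4 / 3 * pi * R ^ 3)"
      using R0 \<rho>(1)
      by (subst Bochner_Integration.integral_add; (intro integrable_mult_right integrable_indicator_cball)?)
         (simp only: integral_mult_right_zero integral_indicator_cball less_imp_le)
    finally show ?thesis .
  qed
  have "\<bar>(\<integral>X. U X * k P X \<partial>lborel) - (\<integral>X. U X * k 0 X \<partial>lborel)\<bar>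
      \<le> (\<delta> * (2 * R) + M) * (L * norm P / R) * (4 / 3 * pi * (2 * R) ^ 3)
      + \<bar>c\<bar> / 2 * (2 * norm P * L * (4 / 3 * pi * \<rho> ^ 3) + (norm P)\<^sup>2 / \<rho> * L * (4 / 3 * pi * R ^ 3))"
    unfolding split N
    using W mult_left_mono[OF B, of "\<bar>c\<bar> / 2"] by (intro order_trans[OF abs_triangle_ineq] add_mono) (auto simp: abs_mult)
  then have "\<bar>((\<integral>X. U X * k P X \<partial>lborel) - (\<integral>X. U X * k 0 X \<partial>lborel)) / R ^ 3\<bar>
      \<le> ((\<delta> * (2 * R) + M) * (L * norm P / R) * (4 / 3 * pi * (2 * R) ^ 3)
      + \<bar>c\<bar> / 2 * (2 * norm P * L * (4 / 3 * pi * \<rho> ^ 3) + (norm P)\<^sup>2 / \<rho> * L * (4 / 3 * pi * R ^ 3))) / R ^ 3"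
    using R0 by (simp add: divide_right_mono)
  also have "\<dots> = (\<delta> * (2 * R) + M) * (L * norm P / R) * (4 / 3 * pi * 8)
      + \<bar>c\<bar> / 2 * (2 * norm P * L * (4 / 3 * pi) * (\<rho> ^ 3 / R ^ 3) + (norm P)\<^sup>2 / \<rho> * L * (4 / 3 * pi))"
    using R0 \<rho>(1) by (simp add: field_simps)
  also have "\<rho> ^ 3 / R ^ 3 = 1 / sqrt R ^ 3"
    unfolding \<rho>(2)[symmetric] using \<rho>(1) by (simp add: \<rho>_def[symmetric] field_simps flip: power_mult power_add)
  also have "(\<delta> * (2 * R) + M) * (L * norm P / R) = L * norm P * (2 * \<delta> + M / R)"
    using R0 by (simp add: field_simps)
  finally show ?thesis by (simp add: \<rho>_def mult_ac)
qed

lemma far_kernel_limit: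
  fixes U :: "R3 \<Rightarrow> real" and P :: R3
  assumes cont: "continuous_on UNIV U"
    and growth: "\<And>\<delta>. \<delta> > 0 \<Longrightarrow> \<exists>M\<ge>0. \<forall>X. \<bar>U X - c * norm X\<bar> \<le> \<delta> * norm X + M"
    and \<epsilon>: "\<epsilon> > 0"
  shows "(\<lambda>n. ((\<integral>X. U X * far_kernel (\<epsilon> / real n) (reg_norm \<epsilon> (X - P) / real n) \<partial>lborel)
      - (\<integral>X. U X * far_kernel (\<epsilon> / real n) (reg_norm \<epsilon> (X - 0) / real n) \<partial>lborel)) / real n ^ 3) \<longlonglongrightarrow> 0"
    (is "?D \<longlonglongrightarrow> 0")
proof (rule tendstoI)
  fix \<eta> :: real assume \<eta>: "\<eta> > 0"
  obtain L where L: "L \<ge> 0" "\<And>e y y'. \<lbrakk>0 \<le> e; e \<le> 1; y \<ge> 0; y' \<ge> 0\<rbrakk> \<Longrightarrow>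
      \<bar>far_kernel e y - far_kernel e y'\<bar> \<le> L * \<bar>y - y'\<bar>"
    using far_kernel_lipschitz by blast
  define K where "K = 32 / 3 * pi * L * norm P"
  have K: "K \<ge> 0" using L(1) by (simp add: K_def)
  \<comment> \<open>The bound for the difference tends to \<open>2 K \<delta>\<close> as n grows,
    not to 0, so \<open>\<delta>\<close> is chosen to keep this below \<open>\<eta>\<close>. The
    summand 1 covers \<open>K = 0\<close>.\<close>
  define \<delta> where "\<delta> = \<eta> / (2 * K + 1) / 2"
  have \<delta>: "\<delta> > 0" using \<eta> K by (simp add: \<delta>_def add_nonneg_pos)
  have "K * (2 * \<delta>) < \<eta>"
  proof -
    have "\<delta> * (2 * (2 * K + 1)) = \<eta>" using K by (simp add: \<delta>_def)
    moreover have "K * (2 * \<delta>) < \<delta> * (2 * (2 * K + 1))" using K \<delta> by (simp add: algebra_simps add_pos_nonneg)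
    ultimately show ?thesis by simp
  qed
  obtain M where M: "M \<ge> 0" "\<And>X. \<bar>U X - c * norm X\<bar> \<le> \<delta> * norm X + M"
    using growth[OF \<delta>] by blast
  define g where "g n = K * (2 * \<delta> + M / real n)
      + \<bar>c\<bar> / 2 * (2 * norm P * L * (4 / 3 * pi) / sqrt (real n) ^ 3 + (norm P)\<^sup>2 * L * (4 / 3 * pi) / sqrt (real n))" for n
  have "(\<lambda>n. (2 * norm P * L * (4 / 3 * pi)) * (1 / sqrt (real n) ^ 3)) \<longlonglongrightarrow> 0"
    by (rule tendsto_mult_right_zero) real_asymp
  moreover have "(\<lambda>n. ((norm P)\<^sup>2 * L * (4 / 3 * pi)) * (1 / sqrt (real n))) \<longlonglongrightarrow> 0"
    by (rule tendsto_mult_right_zero) real_asymp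
  ultimately have "g \<longlonglongrightarrow> K * (2 * \<delta> + 0) + \<bar>c\<bar> / 2 * (0 + 0)"
    unfolding g_def by (intro tendsto_intros lim_const_over_n) simp_all
  then have "\<forall>\<^sub>F n in sequentially. g n < \<eta>"
    using \<open>K * (2 * \<delta>) < \<eta>\<close> by (intro order_tendstoD(2)) auto
  moreover have "\<forall>\<^sub>F n in sequentially. real n \<ge> \<epsilon>" "\<forall>\<^sub>F n in sequentially. real n \<ge> norm P"
    "\<forall>\<^sub>F n in sequentially. real n \<ge> 1"
    using filterlim_real_sequentially by (auto simp: filterlim_at_top)
  ultimately show "\<forall>\<^sub>F n in sequentially. dist (?D n) 0 < \<eta>"
  proof eventually_elim
    case (elim n)
    have "\<bar>?D n\<bar> \<le> g n"
      unfolding g_def K_def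
      by (rule far_kernel_difference_bound[OF cont M(2) less_imp_le[OF \<delta>] M(1) \<epsilon> elim(2-4) L])
    with elim(1) show ?case by simp
  qed
qed

section \<open>The representation formula\<close>

theorem theorem4p4:
  fixes f :: "real^2 \<Rightarrow> real"
    and u :: "(real^2) \<times> real \<Rightarrow> real"
    and a c :: real
  assumes f_smooth: "smooth f"
    and a_gt: "a > 3"
    and f_decay: "f \<in> O[at_infinity](\<lambda>x. norm x powr (-a))"
    and u_smooth: "smooth u"
    and biharm: "\<And>x t. t > 0 \<Longrightarrow> laplacian (laplacian u) (x, t) = 0"
    and bc1: "\<And>x. pderiv_dir (0, 1) u (x, 0) = 0"
    and bc2: "\<And>x. pderiv_dir (0, 1) (laplacian u) (x, 0) = - f x"
    and c_pos: "c > 0"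
    and growth: "\<forall>\<epsilon>>0. \<exists>R. \<forall>x t. t \<ge> 0 \<and> norm (x, t) > R \<longrightarrow>
                    \<bar>u (x, t) / sqrt (t\<^sup>2 + (norm x)\<^sup>2) - c\<bar> < \<epsilon>"
  shows "\<exists>C. \<forall>x t. t \<ge> 0 \<longrightarrow>
           u (x, t) = 1 / (4 * pi) *
             (\<integral>y. sqrt (t\<^sup>2 + (norm (x - y))\<^sup>2) * f y \<partial>lborel) + C"
proof -
  note f_cont = smooth_continuous[OF f_smooth]
  note f_meas = borel_measurable_continuous_UNIV[OF f_cont]
  \<comment> \<open>The decay in global form. The Landau bound holds only for large y; compactness
    covers the ball of radius \<open>s\<close>, and \<open>s \<ge> 1\<close> ensures
    \<open>norm y \<ge> (1 + norm y) / 2\<close> outside it.\<close>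
  obtain K where K: "\<And>y. \<bar>f y\<bar> \<le> K * (1 + norm y) powr (- a)"
  proof -
    obtain k where k: "k > 0" "\<forall>\<^sub>F y in at_infinity. norm (f y) \<le> k * norm (norm y powr (- a))"
      using f_decay by (auto elim: landau_o.bigE)
    then obtain r where r: "\<And>y. norm y \<ge> r \<Longrightarrow> \<bar>f y\<bar> \<le> k * norm y powr (- a)"
      by (auto simp: eventually_at_infinity)
    define s where "s = max r 1"
    obtain B where B: "\<And>y. norm y \<le> s \<Longrightarrow> \<bar>f y\<bar> \<le> B"
    proof -
      have "compact (f ` cball 0 s)"
        by (intro compact_continuous_image continuous_on_subset[OF f_cont] compact_cball) auto
      then obtain B where "\<forall>z \<in> f ` cball 0 s. norm z \<le> B"
        using compact_imp_bounded bounded_iff by metis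
      then show ?thesis by (intro that[of B]) auto
    qed
    have "norm (0 :: real^2) \<le> s" by (simp add: s_def le_max_iff_disj)
    from B[OF this] have B0: "B \<ge> 0" by linarith
    show ?thesis
    proof (rule that)
      fix y :: "real^2"
      have n: "1 + norm y > 0" using norm_ge_zero[of y] by linarith
      show "\<bar>f y\<bar> \<le> (B * (1 + s) powr a + k * 2 powr a) * (1 + norm y) powr (- a)"
      proof (cases "norm y \<le> s")
        case True
        have "1 \<le> ((1 + s) / (1 + norm y)) powr a"
          using True n a_gt by (intro ge_one_powr_ge_zero) auto
        also have "\<dots> = (1 + s) powr a * (1 + norm y) powr (- a)"
          by (subst powr_divide) (use n True in \<open>auto simp: powr_minus divide_simps\<close>)
        finally have "B * 1 \<le> B * ((1 + s) powr a * (1 + norm y) powr (- a))"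
          using B0 by (rule mult_left_mono)
        moreover have "0 \<le> k * 2 powr a * (1 + norm y) powr (- a)" using k by simp
        ultimately show ?thesis using B[OF True] by (simp add: algebra_simps)
      next
        case False
        then have y: "norm y \<ge> r" "norm y \<ge> 1" by (auto simp: s_def)
        have "norm y powr (- a) \<le> ((1 + norm y) / 2) powr (- a)"
          using y a_gt by (intro powr_mono2') auto
        also have "\<dots> = 2 powr a * (1 + norm y) powr (- a)"
          by (subst powr_divide) (use n in \<open>auto simp: powr_minus divide_simps\<close>)
        finally have "k * norm y powr (- a) \<le> k * (2 powr a * (1 + norm y) powr (- a))"
          using k by (intro mult_left_mono) auto
        moreover have "0 \<le> B * (1 + s) powr a * (1 + norm y) powr (- a)" using B0 by simp
        ultimately show ?thesis using r[OF y(1)] by (simp add: algebra_simps)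
      qed
    qed
  qed
  define U where "U X = u (fst X, \<bar>snd X\<bar>)" for X :: R3
  have cU: "continuous_on UNIV U"
    unfolding U_def by (intro continuous_on_compose2[OF smooth_continuous[OF u_smooth]] continuous_intros) auto
  \<comment> \<open>Clearing the denominator makes the asymptotics meaningful at 0 too;
    \<open>M\<close> absorbs the ball on which the growth condition says nothing.\<close>
  have growth': "\<exists>M\<ge>0. \<forall>X. \<bar>U X - c * norm X\<bar> \<le> \<delta> * norm X + M" if \<delta>: "\<delta> > 0" for \<delta>
  proof -
    obtain R where R: "\<And>x t. t \<ge> 0 \<Longrightarrow> norm (x, t) > R \<Longrightarrow> \<bar>u (x, t) / sqrt (t\<^sup>2 + (norm x)\<^sup>2) - c\<bar> < \<delta>"
      using growth \<delta> by blast
    have "continuous_on UNIV (\<lambda>X. U X - c * norm X)" by (intro continuous_intros cU)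
    then have "compact ((\<lambda>X. U X - c * norm X) ` cball 0 \<bar>R\<bar>)"
      by (intro compact_continuous_image compact_cball) (auto intro: continuous_on_subset)
    then obtain M where "\<forall>z \<in> (\<lambda>X. U X - c * norm X) ` cball 0 \<bar>R\<bar>. norm z \<le> M"
      using compact_imp_bounded bounded_iff by metis
    then have M: "\<bar>U X - c * norm X\<bar> \<le> M" if "norm X \<le> \<bar>R\<bar>" for X
      using that by auto
    have M0: "M \<ge> 0" using M[of 0] by simp
    have "\<bar>U X - c * norm X\<bar> \<le> \<delta> * norm X + M" for X
    proof (cases "norm X \<le> \<bar>R\<bar>")
      case True
      then show ?thesis using M[OF True] mult_nonneg_nonneg[OF less_imp_le[OF \<delta>] norm_ge_zero[of X]] by linarith
    next
      case False
      have nX: "norm (fst X, \<bar>snd X\<bar>) = norm X" "sqrt (\<bar>snd X\<bar>\<^sup>2 + (norm (fst X))\<^sup>2) = norm X"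
        by (simp_all add: norm_prod_def add.commute)
      have pos: "norm X > 0" using False by linarith
      have "\<bar>U X / norm X - c\<bar> < \<delta>"
        using R[of "\<bar>snd X\<bar>" "fst X"] False unfolding nX U_def by simp
      then have "\<bar>U X / norm X - c\<bar> * norm X \<le> \<delta> * norm X" using pos by (intro mult_right_mono) auto
      also have "\<bar>U X / norm X - c\<bar> * norm X = \<bar>(U X / norm X - c) * norm X\<bar>" by (simp add: abs_mult)
      also have "(U X / norm X - c) * norm X = U X - c * norm X" using pos by (simp add: field_simps)
      finally show ?thesis using M0 by linarith
    qed
    then show ?thesis using M0 by blast
  qed
  obtain A where A: "\<And>X. \<bar>U X\<bar> \<le> A * (1 + norm X)"
  proof -
    obtain M where M: "M \<ge> 0" "\<And>X. \<bar>U X - c * norm X\<bar> \<le> 1 * norm X + M"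
      using growth'[of 1] by auto
    show ?thesis
    proof (rule that)
      fix X :: R3
      have "0 \<le> M * norm X" "0 \<le> c * norm X" "0 \<le> norm X" using M c_pos by simp_all
      moreover have "(c + 1 + M) * (1 + norm X) = c + 1 + M + c * norm X + norm X + M * norm X"
        by (simp add: algebra_simps)
      ultimately show "\<bar>U X\<bar> \<le> (c + 1 + M) * (1 + norm X)"
        using M(2)[of X] M(1) c_pos by linarith
    qed
  qed
  define N where "N \<epsilon> P = 15 * \<epsilon> ^ 4 * (\<integral>X. U X / reg_norm \<epsilon> (X - P) ^ 7 \<partial>lborel)" for \<epsilon> P
  define F where "F \<epsilon> P = (\<integral>y. f y * reg_norm \<epsilon> ((y, 0) - P) \<partial>lborel)" for \<epsilon> and P :: R3
  have intF: "integrable lborel (\<lambda>y. f y * reg_norm \<epsilon> ((y, 0) - P))" if "\<epsilon> \<ge> 0" for \<epsilon> and P :: R3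
    by (rule integrable_decay_times_reg_norm[OF K a_gt f_meas that])
  \<comment> \<open>The cut-off radius, a natural number n, tends to infinity first, with
    \<open>\<epsilon>\<close> fixed. No convergence of the far terms for \<open>P\<close> and for 0
    separately is claimed, only that of their scaled difference.\<close>
  have regularized: "N \<epsilon> P - N \<epsilon> 0 = 2 * F \<epsilon> P - 2 * F \<epsilon> 0" if \<epsilon>: "\<epsilon> > 0" for \<epsilon> P
  proof -
    define near where "near Q n = 15 * \<epsilon> ^ 4 * (\<integral>X. U X * max 0 (1 / reg_norm \<epsilon> (X - Q) ^ 7 - 1 / real n ^ 7) \<partial>lborel)" for Q n
    define far where "far Q n = (\<integral>X. U X * far_kernel (\<epsilon> / real n) (reg_norm \<epsilon> (X - Q) / real n) \<partial>lborel)" for Q n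
    define bd where "bd Q n = (\<integral>y. f y * (real n * profile 0 ((reg_norm \<epsilon> ((y, 0) - Q) / real n)\<^sup>2)) \<partial>lborel)" for Q :: R3 and n
    have rep: "near Q n - far Q n / real n ^ 3 = 2 * bd Q n" if "n > 0" for Q n
      unfolding near_def far_def bd_def U_def
      using half_space_identity[OF u_smooth biharm bc1 bc2 \<epsilon>, of "real n" Q] that by simp
    have "\<forall>\<^sub>F n in sequentially. (near P n - near 0 n) - (far P n - far 0 n) / real n ^ 3 = 2 * bd P n - 2 * bd 0 n"
      using eventually_gt_at_top[of "0::nat"]
    proof eventually_elim
      case (elim n)
      show ?case unfolding diff_divide_distrib using rep[OF elim, of P] rep[OF elim, of 0] by linarith
    qed
    moreover have "(\<lambda>n. (near P n - near 0 n) - (far P n - far 0 n) / real n ^ 3) \<longlonglongrightarrow> (N \<epsilon> P - N \<epsilon> 0) - 0"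
      unfolding near_def N_def far_def
      by (intro tendsto_diff tendsto_mult_left near_kernel_limit[OF cU A \<epsilon>] far_kernel_limit[OF cU growth' \<epsilon>])
    ultimately have "(\<lambda>n. 2 * bd P n - 2 * bd 0 n) \<longlonglongrightarrow> (N \<epsilon> P - N \<epsilon> 0) - 0"
      by (rule Lim_transform_eventually[rotated])
    moreover have "(\<lambda>n. 2 * bd P n - 2 * bd 0 n) \<longlonglongrightarrow> 2 * F \<epsilon> P - 2 * F \<epsilon> 0"
      unfolding bd_def F_def using \<epsilon>
      by (intro tendsto_diff tendsto_mult_left boundary_limit intF f_meas) auto
    ultimately show ?thesis using LIMSEQ_unique by fastforce
  qed
  define G where "G P = (\<integral>y. f y * norm ((y, 0) - P) \<partial>lborel)" for P :: R3
  have identity: "8 * pi * U P - 8 * pi * U 0 = 2 * G P - 2 * G 0" for P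
  proof (rule LIMSEQ_unique)
    let ?\<delta> = "\<lambda>n. inverse (real (Suc n))"
    show "(\<lambda>n. N (?\<delta> n) P - N (?\<delta> n) 0) \<longlonglongrightarrow> 8 * pi * U P - 8 * pi * U 0"
      unfolding N_def by (intro tendsto_diff approximate_identity[OF cU A])
    have "(\<lambda>n. 2 * F (?\<delta> n) P - 2 * F (?\<delta> n) 0) \<longlonglongrightarrow> 2 * G P - 2 * G 0"
      unfolding F_def G_def
      by (intro tendsto_diff tendsto_mult_left boundary_regularization_limit[OF K a_gt f_meas])
    then show "(\<lambda>n. N (?\<delta> n) P - N (?\<delta> n) 0) \<longlonglongrightarrow> 2 * G P - 2 * G 0"
      by (simp add: regularized)
  qed
  have "u (x, t) = 1 / (4 * pi) * (\<integral>y. sqrt (t\<^sup>2 + (norm (x - y))\<^sup>2) * f y \<partial>lborel) + (U 0 - G 0 / (4 * pi))"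
    if "t \<ge> 0" for x t
  proof -
    have "G (x, t) = (\<integral>y. sqrt (t\<^sup>2 + (norm (x - y))\<^sup>2) * f y \<partial>lborel)"
      unfolding G_def by (intro Bochner_Integration.integral_cong refl)
        (simp add: norm_Pair norm_minus_commute add.commute mult.commute)
    moreover have "u (x, t) = U (x, t)" using that by (simp add: U_def)
    moreover have "U (x, t) - U 0 = (G (x, t) - G 0) / (4 * pi)"
      using identity[of "(x, t)"] by (simp add: eq_divide_eq algebra_simps)
    ultimately show ?thesis by (simp add: diff_divide_distrib)
  qed
  then show ?thesis by blast
qed

end
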